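(* The symmetry group $\operatorname{Sym}_{(2,3,8)}(B)=\Delta_{(2,3,8)}/B$ is isomorphic to $GL_2(\mathbb{F}_3)$.
   Context: $\Delta_{(2,3,8)}=\langle x,y\mid x^2=y^3=(xy)^8=1\rangle$ and $\Delta_{(3,3,4)}=\langle\alpha,\beta\mid\alpha^3=\beta^3=(\alpha\beta)^4=1\rangle$; the latter is embedded as a subgroup of index $2$ in the former via $\alpha\mapsto y$, $\beta\mapsto xyx$. The Bolza group $B$ is the normal subgroup of $\Delta_{(3,3,4)}$ generated, as a normal subgroup, by $(\alpha\beta)^2(\alpha^2\beta^2)^2$; it is regarded as a subgroup of $\Delta_{(2,3,8)}$ through the embedding, and it is normal in $\Delta_{(2,3,8)}$. *)

theory Defs
  imports
    "HOL-Algebra.Coset"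
    "HOL-Library.Numeral_Type"
    "HOL-Analysis.Cartesian_Space"
begin

section \<open>Free groups\<close>

text \<open>
  A letter \<open>(a, True)\<close> stands for the generator \<open>a\<close> and \<open>(a, False)\<close> for its formal inverse.
  Words are identified when they differ by insertions and deletions of pairs of adjacent
  mutually inverse letters.
\<close>

inductive free_eq :: "('a \<times> bool) list \<Rightarrow> ('a \<times> bool) list \<Rightarrow> bool" where
  cancel: "free_eq (u @ [(a, s), (a, \<not> s)] @ v) (u @ v)"
| refl: "free_eq w w"
| sym: "free_eq v w \<Longrightarrow> free_eq w v"
| trans: "free_eq u v \<Longrightarrow> free_eq v w \<Longrightarrow> free_eq u w"

lemma equivp_free_eq: "equivp free_eq"
  by (rule equivpI) (auto intro!: reflpI sympI transpI intro: free_eq.intros)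

quotient_type 'a free_elem = "('a \<times> bool) list" / free_eq
  by (rule equivp_free_eq)

lemma free_eq_append:
  assumes "free_eq u u'" "free_eq v v'"
  shows "free_eq (u @ v) (u' @ v')"
proof -
  have l: "free_eq (w @ u) (w @ u')" if "free_eq u u'" for u u' w :: "('a \<times> bool) list"
    using that
  proof induction
    case (cancel u a s v)
    show ?case using free_eq.cancel[of "w @ u" a s v] by simp
  qed (auto intro: free_eq.intros)
  have r: "free_eq (u @ w) (u' @ w)" if "free_eq u u'" for u u' w :: "('a \<times> bool) list"
    using that
  proof induction
    case (cancel u a s v)
    show ?case using free_eq.cancel[of u a s "v @ w"] by simp
  qed (auto intro: free_eq.intros)
  show ?thesis using l[OF assms(2)] r[OF assms(1)] by (blast intro: free_eq.trans)
qed

lift_definition free_mult :: "'a free_elem \<Rightarrow> 'a free_elem \<Rightarrow> 'a free_elem" is append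
  by (rule free_eq_append)

lift_definition free_one :: "'a free_elem" is "[]" .

lift_definition free_gen :: "'a \<Rightarrow> 'a free_elem" is "\<lambda>a. [(a, True)]" .

definition free_group :: "'a free_elem monoid" where
  "free_group = \<lparr>carrier = UNIV, mult = free_mult, one = free_one\<rparr>"

lemma free_eq_inverse:
  "free_eq (rev (map (\<lambda>(a, s). (a, \<not> s)) w) @ w) []"
proof (induction w)
  case Nil
  show ?case by (simp add: free_eq.refl)
next
  case (Cons l w)
  obtain a s where l: "l = (a, s)" by force
  have "free_eq (rev (map (\<lambda>(a, s). (a, \<not> s)) w) @ [(a, \<not> s), (a, \<not> \<not> s)] @ w)
    (rev (map (\<lambda>(a, s). (a, \<not> s)) w) @ w)"
    by (rule free_eq.cancel)
  with Cons.IH show ?case by (auto simp: l intro: free_eq.trans)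
qed

lemma group_free_group: "group (free_group :: 'a free_elem monoid)"
proof (rule groupI)
  fix x y z :: "'a free_elem"
  show "x \<otimes>\<^bsub>free_group\<^esub> y \<otimes>\<^bsub>free_group\<^esub> z = x \<otimes>\<^bsub>free_group\<^esub> (y \<otimes>\<^bsub>free_group\<^esub> z)"
    by (simp add: free_group_def) (transfer, simp add: free_eq.refl)
  show "\<one>\<^bsub>free_group\<^esub> \<otimes>\<^bsub>free_group\<^esub> x = x"
    by (simp add: free_group_def) (transfer, simp add: free_eq.refl)
  have "\<exists>y. free_mult y x = free_one"
    by transfer (use free_eq_inverse in blast)
  thus "\<exists>y\<in>carrier free_group. y \<otimes>\<^bsub>free_group\<^esub> x = \<one>\<^bsub>free_group\<^esub>"
    by (simp add: free_group_def)
qed (auto simp: free_group_def)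

text \<open>The value of a word under an assignment \<open>f\<close> of the generators in a group \<open>H\<close>.\<close>

definition word_eval :: "('b, 'c) monoid_scheme \<Rightarrow> ('a \<Rightarrow> 'b) \<Rightarrow> ('a \<times> bool) list \<Rightarrow> 'b" where
  "word_eval H f w =
    foldr (\<lambda>(a, s) h. (if s then f a else inv\<^bsub>H\<^esub> f a) \<otimes>\<^bsub>H\<^esub> h) w \<one>\<^bsub>H\<^esub>"

definition free_lift :: "('b, 'c) monoid_scheme \<Rightarrow> ('a \<Rightarrow> 'b) \<Rightarrow> 'a free_elem \<Rightarrow> 'b" where
  "free_lift H f W = word_eval H f (rep_free_elem W)"

context
  fixes H :: "('b, 'c) monoid_scheme" and f :: "'a \<Rightarrow> 'b"
  assumes H: "group H" and f: "\<And>a. f a \<in> carrier H"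
begin

interpretation H: group H by (rule H)

lemma word_eval_closed: "word_eval H f w \<in> carrier H"
  by (induction w) (auto simp: word_eval_def f)

lemma word_eval_append: "word_eval H f (u @ v) = word_eval H f u \<otimes>\<^bsub>H\<^esub> word_eval H f v"
proof (induction u)
  case Nil
  show ?case using word_eval_closed[of v] by (simp add: word_eval_def)
next
  case (Cons l u)
  have "word_eval H f (l # w)
      = (if snd l then f (fst l) else inv\<^bsub>H\<^esub> f (fst l)) \<otimes>\<^bsub>H\<^esub> word_eval H f w" for w
    by (simp add: word_eval_def case_prod_beta)
  with Cons show ?case
    using word_eval_closed[of u] word_eval_closed[of v] by (simp add: f H.m_assoc)
qed

lemma word_eval_cong: "free_eq u v \<Longrightarrow> word_eval H f u = word_eval H f v"
proof (induction rule: free_eq.induct)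
  case (cancel u a s v)
  have "word_eval H f [(a, s), (a, \<not> s)] = \<one>\<^bsub>H\<^esub>"
    by (simp add: word_eval_def f)
  thus ?case
    using word_eval_closed[of v] by (simp only: word_eval_append H.l_one)
qed auto

lemma free_lift_abs: "free_lift H f (abs_free_elem w) = word_eval H f w"
  unfolding free_lift_def
  by (rule word_eval_cong)
    (metis Quotient3_abs_rep Quotient3_free_elem Quotient3_rel_rep free_elem.abs_eq_iff)

lemma free_lift_hom: "free_lift H f \<in> hom free_group H"
proof (rule homI)
  fix x y :: "'a free_elem"
  show "free_lift H f x \<in> carrier H"
    unfolding free_lift_def by (rule word_eval_closed)
  obtain u v where "x = abs_free_elem u" "y = abs_free_elem v"
    by (metis Quotient3_abs_rep Quotient3_free_elem)
  thus "free_lift H f (x \<otimes>\<^bsub>free_group\<^esub> y) = free_lift H f x \<otimes>\<^bsub>H\<^esub> free_lift H f y"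
    by (simp add: free_group_def free_mult.abs_eq free_lift_abs word_eval_append)
qed

lemma free_lift_gen: "free_lift H f (free_gen a) = f a"
  by (simp add: free_gen.abs_eq free_lift_abs) (simp add: word_eval_def f)

end

lemma free_hom_eqI:
  fixes H :: "('b, 'c) monoid_scheme" and g h :: "'a free_elem \<Rightarrow> 'b"
  assumes H: "group H" and g: "g \<in> hom free_group H" and h: "h \<in> hom free_group H"
    and eq: "\<And>a. g (free_gen a) = h (free_gen a)"
  shows "g W = h W"
proof -
  interpret F: group free_group by (rule group_free_group)
  interpret g: group_hom free_group H g
    using H g by (simp add: group_hom_def group_hom_axioms_def group_free_group)
  interpret h: group_hom free_group H h
    using H h by (simp add: group_hom_def group_hom_axioms_def group_free_group)
  have c: "x \<in> carrier free_group" for x :: "'a free_elem" by (simp add: free_group_def)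
  have inv: "abs_free_elem [(a, False)] = inv\<^bsub>free_group\<^esub> (free_gen a)" for a :: 'a
  proof (rule F.inv_equality[symmetric])
    show "abs_free_elem [(a, False)] \<otimes>\<^bsub>free_group\<^esub> free_gen a = \<one>\<^bsub>free_group\<^esub>"
      using free_eq.cancel[of "[]" a False "[]"]
      by (simp add: free_group_def free_gen.abs_eq free_mult.abs_eq free_one.abs_eq
          free_elem.abs_eq_iff)
  qed (rule c)+
  have "g (abs_free_elem w) = h (abs_free_elem w)" for w
  proof (induction w)
    case Nil
    have "abs_free_elem [] = \<one>\<^bsub>free_group\<^esub>" by (simp add: free_group_def free_one.abs_eq)
    thus ?case by (metis g.hom_one h.hom_one)
  next
    case (Cons l w)
    obtain a s where l: "l = (a, s)" by force
    have "abs_free_elem (l # w) = abs_free_elem [l] \<otimes>\<^bsub>free_group\<^esub> abs_free_elem w"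
      by (simp add: free_group_def free_mult.abs_eq)
    moreover have "g (abs_free_elem [l]) = h (abs_free_elem [l])"
    proof (cases s)
      case True
      thus ?thesis using eq[of a] by (simp add: l free_gen.abs_eq)
    next
      case False
      thus ?thesis using eq[of a] by (simp add: l inv c)
    qed
    ultimately show ?case using Cons.IH by (simp add: c)
  qed
  thus ?thesis by (metis Quotient3_abs_rep Quotient3_free_elem)
qed


section \<open>Normal closures and group presentations\<close>

definition normal_closure :: "('a, 'b) monoid_scheme \<Rightarrow> 'a set \<Rightarrow> 'a set" where
  "normal_closure G S = \<Inter>{N. N \<lhd> G \<and> S \<subseteq> N}"

lemma subset_normal_closure: "S \<subseteq> normal_closure G S"
  by (auto simp: normal_closure_def)

lemma normal_closure_least: "N \<lhd> G \<Longrightarrow> S \<subseteq> N \<Longrightarrow> normal_closure G S \<subseteq> N"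
  by (auto simp: normal_closure_def)

lemma (in group) carrier_normal: "carrier G \<lhd> G"
  by (rule normal_invI) (auto intro: subgroup_self)

lemma (in group) normal_closure_normal:
  assumes "S \<subseteq> carrier G"
  shows "normal_closure G S \<lhd> G"
proof (rule normal_invI)
  have *: "carrier G \<in> {N. N \<lhd> G \<and> S \<subseteq> N}"
    using assms carrier_normal by auto
  show "subgroup (normal_closure G S) G"
    unfolding normal_closure_def
    by (rule subgroups_Inter) (use * in \<open>auto intro: normal_imp_subgroup\<close>)
  fix x h assume "x \<in> carrier G" "h \<in> normal_closure G S"
  thus "x \<otimes> h \<otimes> inv x \<in> normal_closure G S"
    by (auto simp: normal_closure_def normal.inv_op_closed2)
qed

definition presented_group :: "'a free_elem set \<Rightarrow> 'a free_elem set monoid" where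
  "presented_group R = free_group Mod normal_closure free_group R"

definition presented_gen :: "'a free_elem set \<Rightarrow> 'a \<Rightarrow> 'a free_elem set" where
  "presented_gen R a = normal_closure free_group R #>\<^bsub>free_group\<^esub> free_gen a"

text \<open>
  The homomorphism out of a presented group with prescribed images \<open>f\<close> of the generators.
  It is well defined whenever \<open>f\<close> satisfies the relations, see the lemmas
  \<open>presented_lift_hom\<close>, \<open>presented_lift_gen\<close> and \<open>presented_hom_eqI\<close> below.
\<close>

definition presented_lift :: "('b, 'c) monoid_scheme \<Rightarrow> ('a \<Rightarrow> 'b) \<Rightarrow> 'a free_elem set \<Rightarrow> 'b" where
  "presented_lift H f C = the_elem (free_lift H f ` C)"

lemma free_relators_normal: "normal_closure free_group R \<lhd> free_group"
  by (rule group.normal_closure_normal[OF group_free_group]) (simp add: free_group_def)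

lemma group_presented_group: "group (presented_group R)"
  unfolding presented_group_def by (rule normal.factorgroup_is_group[OF free_relators_normal])

lemma presented_proj_hom:
  "(\<lambda>w. normal_closure free_group R #>\<^bsub>free_group\<^esub> w) \<in> hom free_group (presented_group R)"
  unfolding presented_group_def by (rule normal.r_coset_hom_Mod[OF free_relators_normal])

lemma presented_carrierE:
  assumes "C \<in> carrier (presented_group R)"
  obtains w where "C = normal_closure free_group R #>\<^bsub>free_group\<^esub> w"
  using assms by (auto simp: presented_group_def FactGroup_def RCOSETS_def)

lemma presented_gen_closed [simp]: "presented_gen R a \<in> carrier (presented_group R)"
  using presented_proj_hom[of R] by (auto simp: presented_gen_def hom_def free_group_def)

lemma presented_hom_eqI:
  assumes "group H" "g \<in> hom (presented_group R) H" "h \<in> hom (presented_group R) H"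
    and "\<And>a. g (presented_gen R a) = h (presented_gen R a)"
    and "C \<in> carrier (presented_group R)"
  shows "g C = h C"
proof -
  obtain w where w: "C = normal_closure free_group R #>\<^bsub>free_group\<^esub> w"
    using assms(5) by (rule presented_carrierE)
  have "(g \<circ> (\<lambda>w. normal_closure free_group R #>\<^bsub>free_group\<^esub> w)) w
      = (h \<circ> (\<lambda>w. normal_closure free_group R #>\<^bsub>free_group\<^esub> w)) w"
    by (rule free_hom_eqI[OF assms(1) hom_compose[OF presented_proj_hom assms(2)]
          hom_compose[OF presented_proj_hom assms(3)]])
      (use assms(4) in \<open>simp add: presented_gen_def\<close>)
  thus ?thesis by (simp add: w)
qed

lemma presented_group_generated:
  assumes N: "subgroup N (presented_group R)" and gens: "\<And>a. presented_gen R a \<in> N"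
  shows "N = carrier (presented_group R)"
proof
  let ?P = "presented_group R" and ?Q = "presented_group R\<lparr>carrier := N\<rparr>"
  interpret P: group ?P by (rule group_presented_group)
  interpret Q: group ?Q by (rule P.subgroup_imp_group[OF N])
  have sub: "N \<subseteq> carrier ?P" by (rule subgroup.subset[OF N])
  have f: "presented_gen R a \<in> carrier ?Q" for a using gens by simp
  have incl: "(\<lambda>u. u) \<in> hom ?Q ?P" using sub by (auto simp: hom_def)
  interpret fP: group_hom free_group ?P "free_lift ?Q (presented_gen R)"
    using hom_compose[OF free_lift_hom[OF Q.is_group f] incl]
    by (simp add: group_hom_def group_hom_axioms_def group_free_group comp_def
        group_presented_group)
  have proj: "free_lift ?Q (presented_gen R) w = normal_closure free_group R #>\<^bsub>free_group\<^esub> w" for w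
    by (rule free_hom_eqI[OF P.is_group fP.homh presented_proj_hom])
      (simp only: free_lift_gen[OF Q.is_group f] presented_gen_def)
  show "N \<subseteq> carrier ?P" by (rule sub)
  show "carrier ?P \<subseteq> N"
  proof
    fix C assume "C \<in> carrier ?P"
    then obtain w where "C = normal_closure free_group R #>\<^bsub>free_group\<^esub> w"
      by (rule presented_carrierE)
    moreover have "free_lift ?Q (presented_gen R) w \<in> carrier ?Q"
      by (rule hom_in_carrier[OF free_lift_hom[OF Q.is_group f]]) (simp add: free_group_def)
    ultimately show "C \<in> N" by (simp add: proj)
  qed
qed

context
  fixes H :: "('b, 'c) monoid_scheme" and f :: "'a \<Rightarrow> 'b" and R :: "'a free_elem set"
  assumes H: "group H" and f: "\<And>a. f a \<in> carrier H"
    and R: "\<And>r. r \<in> R \<Longrightarrow> free_lift H f r = \<one>\<^bsub>H\<^esub>"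
begin

interpretation fl: group_hom free_group H "free_lift H f"
  using H free_lift_hom[where H = H and f = f]
  by (simp add: group_hom_def group_hom_axioms_def group_free_group f)

lemma presented_lift_proj:
  "presented_lift H f (normal_closure free_group R #>\<^bsub>free_group\<^esub> w) = free_lift H f w"
proof -
  let ?N = "normal_closure free_group R"
  have c: "x \<in> carrier free_group" for x :: "'a free_elem" by (simp add: free_group_def)
  have "?N \<subseteq> kernel free_group H (free_lift H f)"
    by (rule normal_closure_least[OF fl.normal_kernel]) (auto simp: kernel_def R c)
  hence k: "free_lift H f (n \<otimes>\<^bsub>free_group\<^esub> w) = free_lift H f w" if "n \<in> ?N" for n
    using that by (auto simp: kernel_def c)
  have "\<one>\<^bsub>free_group\<^esub> \<in> ?N"
    by (rule subgroup.one_closed[OF normal_imp_subgroup[OF free_relators_normal]])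
  hence "free_lift H f ` (?N #>\<^bsub>free_group\<^esub> w) = {free_lift H f w}"
    by (auto simp: r_coset_def image_UN k)
  thus ?thesis by (simp add: presented_lift_def)
qed

lemma presented_lift_gen: "presented_lift H f (presented_gen R a) = f a"
  by (simp only: presented_gen_def presented_lift_proj free_lift_gen[where H = H and f = f, OF H f])

lemma presented_lift_hom: "presented_lift H f \<in> hom (presented_group R) H"
proof (rule homI)
  fix C D assume C: "C \<in> carrier (presented_group R)" and D: "D \<in> carrier (presented_group R)"
  obtain v where v: "C = normal_closure free_group R #>\<^bsub>free_group\<^esub> v"
    using C by (rule presented_carrierE)
  obtain w where w: "D = normal_closure free_group R #>\<^bsub>free_group\<^esub> w"
    using D by (rule presented_carrierE)
  have c: "x \<in> carrier free_group" for x :: "'a free_elem" by (simp add: free_group_def)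
  show "presented_lift H f C \<in> carrier H"
    by (simp add: v presented_lift_proj c)
  have "C \<otimes>\<^bsub>presented_group R\<^esub> D
      = normal_closure free_group R #>\<^bsub>free_group\<^esub> (v \<otimes>\<^bsub>free_group\<^esub> w)"
    unfolding v w by (rule hom_mult[OF presented_proj_hom c c, symmetric])
  thus "presented_lift H f (C \<otimes>\<^bsub>presented_group R\<^esub> D)
      = presented_lift H f C \<otimes>\<^bsub>H\<^esub> presented_lift H f D"
    by (simp only: v w presented_lift_proj fl.hom_mult c)
qed

end


section \<open>Triangle groups and the Bolza group\<close>

datatype tri_gen = Gen1 | Gen2

definition triangle_relators :: "nat \<Rightarrow> nat \<Rightarrow> nat \<Rightarrow> tri_gen free_elem set" where
  "triangle_relators p q r =
    {free_gen Gen1 [^]\<^bsub>free_group\<^esub> p,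
     free_gen Gen2 [^]\<^bsub>free_group\<^esub> q,
     (free_gen Gen1 \<otimes>\<^bsub>free_group\<^esub> free_gen Gen2) [^]\<^bsub>free_group\<^esub> r}"

definition triangle_group :: "nat \<Rightarrow> nat \<Rightarrow> nat \<Rightarrow> tri_gen free_elem set monoid" where
  "triangle_group p q r = presented_group (triangle_relators p q r)"

definition Delta238 :: "tri_gen free_elem set monoid" where
  "Delta238 = triangle_group 2 3 8"

definition gx :: "tri_gen free_elem set" where
  "gx = presented_gen (triangle_relators 2 3 8) Gen1"

definition gy :: "tri_gen free_elem set" where
  "gy = presented_gen (triangle_relators 2 3 8) Gen2"

definition Delta334 :: "tri_gen free_elem set monoid" where
  "Delta334 = triangle_group 3 3 4"

definition g\<alpha> :: "tri_gen free_elem set" where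
  "g\<alpha> = presented_gen (triangle_relators 3 3 4) Gen1"

definition g\<beta> :: "tri_gen free_elem set" where
  "g\<beta> = presented_gen (triangle_relators 3 3 4) Gen2"

definition Delta_embedding :: "tri_gen free_elem set \<Rightarrow> tri_gen free_elem set" where
  "Delta_embedding = presented_lift Delta238
    (case_tri_gen gy (gx \<otimes>\<^bsub>Delta238\<^esub> gy \<otimes>\<^bsub>Delta238\<^esub> gx))"

definition Bolza_group :: "tri_gen free_elem set set" where
  "Bolza_group = normal_closure Delta334
    {(g\<alpha> \<otimes>\<^bsub>Delta334\<^esub> g\<beta>) [^]\<^bsub>Delta334\<^esub> (2::nat) \<otimes>\<^bsub>Delta334\<^esub>
     (g\<alpha> [^]\<^bsub>Delta334\<^esub> (2::nat) \<otimes>\<^bsub>Delta334\<^esub> g\<beta> [^]\<^bsub>Delta334\<^esub> (2::nat)) [^]\<^bsub>Delta334\<^esub> (2::nat)}"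


lemma group_triangle_group: "group (triangle_group p q r)"
  unfolding triangle_group_def by (rule group_presented_group)

lemma triangle_lift:
  assumes H: "group H" and "a \<in> carrier H" "b \<in> carrier H"
    and "a [^]\<^bsub>H\<^esub> p = \<one>\<^bsub>H\<^esub>" "b [^]\<^bsub>H\<^esub> q = \<one>\<^bsub>H\<^esub>" "(a \<otimes>\<^bsub>H\<^esub> b) [^]\<^bsub>H\<^esub> r = \<one>\<^bsub>H\<^esub>"
  defines "h \<equiv> presented_lift H (case_tri_gen a b)"
  shows "h \<in> hom (triangle_group p q r) H"
    and "h (presented_gen (triangle_relators p q r) Gen1) = a"
    and "h (presented_gen (triangle_relators p q r) Gen2) = b"
proof -
  have f: "case_tri_gen a b t \<in> carrier H" for t
    using assms(2,3) by (cases t) auto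
  interpret fl: group_hom free_group H "free_lift H (case_tri_gen a b)"
    using H free_lift_hom[OF H f]
    by (simp add: group_hom_def group_hom_axioms_def group_free_group)
  have c: "w \<in> carrier free_group" for w :: "tri_gen free_elem" by (simp add: free_group_def)
  have R: "free_lift H (case_tri_gen a b) w = \<one>\<^bsub>H\<^esub>" if "w \<in> triangle_relators p q r" for w
    using that assms(2-6)
    by (auto simp: triangle_relators_def fl.hom_nat_pow c free_lift_gen[OF H f])
  show "h \<in> hom (triangle_group p q r) H"
    unfolding h_def triangle_group_def by (rule presented_lift_hom[OF H f R])
  show "h (presented_gen (triangle_relators p q r) Gen1) = a"
    unfolding h_def by (subst presented_lift_gen[OF H f R]) auto
  show "h (presented_gen (triangle_relators p q r) Gen2) = b"
    unfolding h_def by (subst presented_lift_gen[OF H f R]) auto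
qed

lemma triangle_hom_eqI:
  assumes "group H" "g \<in> hom (triangle_group p q r) H" "h \<in> hom (triangle_group p q r) H"
    and "g (presented_gen (triangle_relators p q r) Gen1)
       = h (presented_gen (triangle_relators p q r) Gen1)"
    and "g (presented_gen (triangle_relators p q r) Gen2)
       = h (presented_gen (triangle_relators p q r) Gen2)"
    and "C \<in> carrier (triangle_group p q r)"
  shows "g C = h C"
proof -
  have "g (presented_gen (triangle_relators p q r) t)
      = h (presented_gen (triangle_relators p q r) t)" for t
    using assms(4,5) by (cases t) auto
  thus ?thesis
    by (rule presented_hom_eqI[OF assms(1) assms(2,3)[unfolded triangle_group_def] _
          assms(6)[unfolded triangle_group_def]])
qed

lemma triangle_relations:
  fixes p q r
  defines "R \<equiv> triangle_relators p q r" and "T \<equiv> triangle_group p q r"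
  shows "presented_gen R Gen1 [^]\<^bsub>T\<^esub> p = \<one>\<^bsub>T\<^esub>"
    and "presented_gen R Gen2 [^]\<^bsub>T\<^esub> q = \<one>\<^bsub>T\<^esub>"
    and "(presented_gen R Gen1 \<otimes>\<^bsub>T\<^esub> presented_gen R Gen2) [^]\<^bsub>T\<^esub> r = \<one>\<^bsub>T\<^esub>"
proof -
  let ?N = "normal_closure free_group R"
  interpret N: normal ?N free_group by (rule free_relators_normal)
  interpret pr: group_hom free_group T "\<lambda>w. ?N #>\<^bsub>free_group\<^esub> w"
    using presented_proj_hom[of R] group_presented_group[of R] group_free_group
    by (simp add: group_hom_def group_hom_axioms_def T_def R_def triangle_group_def)
  have c: "w \<in> carrier free_group" for w :: "tri_gen free_elem" by (simp add: free_group_def)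
  have *: "?N #>\<^bsub>free_group\<^esub> w = \<one>\<^bsub>T\<^esub>" if "w \<in> R" for w
  proof -
    have "w \<in> ?N" by (rule subsetD[OF subset_normal_closure that])
    hence "?N #>\<^bsub>free_group\<^esub> w = ?N" by (rule N.rcos_const[OF group_free_group])
    thus ?thesis
      by (simp add: T_def triangle_group_def presented_group_def FactGroup_def R_def)
  qed
  have "free_gen Gen1 [^]\<^bsub>free_group\<^esub> p \<in> R"
    by (simp add: R_def triangle_relators_def)
  from *[OF this] show "presented_gen R Gen1 [^]\<^bsub>T\<^esub> p = \<one>\<^bsub>T\<^esub>"
    by (simp add: presented_gen_def pr.hom_nat_pow c)
  have "free_gen Gen2 [^]\<^bsub>free_group\<^esub> q \<in> R"
    by (simp add: R_def triangle_relators_def)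
  from *[OF this] show "presented_gen R Gen2 [^]\<^bsub>T\<^esub> q = \<one>\<^bsub>T\<^esub>"
    by (simp add: presented_gen_def pr.hom_nat_pow c)
  have "(free_gen Gen1 \<otimes>\<^bsub>free_group\<^esub> free_gen Gen2) [^]\<^bsub>free_group\<^esub> r \<in> R"
    by (simp add: R_def triangle_relators_def)
  from *[OF this] show "(presented_gen R Gen1 \<otimes>\<^bsub>T\<^esub> presented_gen R Gen2) [^]\<^bsub>T\<^esub> r = \<one>\<^bsub>T\<^esub>"
    by (simp add: presented_gen_def pr.hom_nat_pow c)
qed

lemma group_Delta238: "group Delta238" and group_Delta334: "group Delta334"
  by (simp_all add: Delta238_def Delta334_def group_triangle_group)

interpretation D: group Delta238 by (rule group_Delta238)
interpretation E: group Delta334 by (rule group_Delta334)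

lemma Delta_gens_closed [simp]:
  "gx \<in> carrier Delta238" "gy \<in> carrier Delta238"
  "g\<alpha> \<in> carrier Delta334" "g\<beta> \<in> carrier Delta334"
  by (simp_all add: gx_def gy_def g\<alpha>_def g\<beta>_def Delta238_def Delta334_def triangle_group_def)

lemma Delta238_relations:
  "gx [^]\<^bsub>Delta238\<^esub> (2::nat) = \<one>\<^bsub>Delta238\<^esub>"
  "gy [^]\<^bsub>Delta238\<^esub> (3::nat) = \<one>\<^bsub>Delta238\<^esub>"
  "(gx \<otimes>\<^bsub>Delta238\<^esub> gy) [^]\<^bsub>Delta238\<^esub> (8::nat) = \<one>\<^bsub>Delta238\<^esub>"
  unfolding gx_def gy_def Delta238_def by (rule triangle_relations)+

lemma Delta334_relations:
  "g\<alpha> [^]\<^bsub>Delta334\<^esub> (3::nat) = \<one>\<^bsub>Delta334\<^esub>"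
  "g\<beta> [^]\<^bsub>Delta334\<^esub> (3::nat) = \<one>\<^bsub>Delta334\<^esub>"
  "(g\<alpha> \<otimes>\<^bsub>Delta334\<^esub> g\<beta>) [^]\<^bsub>Delta334\<^esub> (4::nat) = \<one>\<^bsub>Delta334\<^esub>"
  unfolding g\<alpha>_def g\<beta>_def Delta334_def by (rule triangle_relations)+

lemma (in group) conj_mult:
  assumes "g \<in> carrier G" "h \<in> carrier G" "k \<in> carrier G"
  shows "g \<otimes> (h \<otimes> k) \<otimes> inv g = (g \<otimes> h \<otimes> inv g) \<otimes> (g \<otimes> k \<otimes> inv g)"
proof -
  have "(g \<otimes> h \<otimes> inv g) \<otimes> (g \<otimes> k \<otimes> inv g) = g \<otimes> h \<otimes> (inv g \<otimes> g) \<otimes> k \<otimes> inv g"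
    using assms by (simp only: m_assoc inv_closed m_closed)
  thus ?thesis using assms by (simp add: m_assoc)
qed

lemma (in group) conj_pow:
  assumes "g \<in> carrier G" "h \<in> carrier G"
  shows "(g \<otimes> h \<otimes> inv g) [^] (n::nat) = g \<otimes> h [^] n \<otimes> inv g"
  by (induction n) (use assms in \<open>simp_all add: conj_mult\<close>)

lemma (in group) swap_pow:
  assumes "a \<in> carrier G" "b \<in> carrier G" "(a \<otimes> b) [^] (n::nat) = \<one>"
  shows "(b \<otimes> a) [^] n = \<one>"
proof -
  have "b \<otimes> a = inv a \<otimes> (a \<otimes> b) \<otimes> inv (inv a)"
    using assms(1,2) by (simp add: m_assoc[symmetric])
  hence "(b \<otimes> a) [^] n = inv a \<otimes> (a \<otimes> b) [^] n \<otimes> inv (inv a)"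
    using conj_pow[of "inv a" "a \<otimes> b" n] assms(1,2) by simp
  thus ?thesis using assms by simp
qed

lemma gx_square: "gx \<otimes>\<^bsub>Delta238\<^esub> gx = \<one>\<^bsub>Delta238\<^esub>"
  using Delta238_relations(1) by (simp add: numeral_2_eq_2)

lemma inv_gx: "inv\<^bsub>Delta238\<^esub> gx = gx"
  by (rule D.inv_equality) (simp_all add: gx_square)

lemma Delta_embedding:
  shows Delta_embedding_hom: "Delta_embedding \<in> hom Delta334 Delta238"
    and Delta_embedding_alpha: "Delta_embedding g\<alpha> = gy"
    and Delta_embedding_beta: "Delta_embedding g\<beta> = gx \<otimes>\<^bsub>Delta238\<^esub> gy \<otimes>\<^bsub>Delta238\<^esub> gx"
proof -
  let ?b = "gx \<otimes>\<^bsub>Delta238\<^esub> gy \<otimes>\<^bsub>Delta238\<^esub> gx"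
  have b: "?b \<in> carrier Delta238" by simp
  have b3: "?b [^]\<^bsub>Delta238\<^esub> (3::nat) = \<one>\<^bsub>Delta238\<^esub>"
    using D.conj_pow[of gx gy 3] by (simp add: inv_gx Delta238_relations gx_square)
  have yx: "(gy \<otimes>\<^bsub>Delta238\<^esub> gx) [^]\<^bsub>Delta238\<^esub> (2 * 4::nat) = \<one>\<^bsub>Delta238\<^esub>"
    using D.swap_pow[of gx gy 8] Delta238_relations(3) by simp
  have "(gy \<otimes>\<^bsub>Delta238\<^esub> gx) [^]\<^bsub>Delta238\<^esub> (2::nat) = gy \<otimes>\<^bsub>Delta238\<^esub> ?b"
    by (simp add: numeral_2_eq_2 D.m_assoc)
  hence ab4: "(gy \<otimes>\<^bsub>Delta238\<^esub> ?b) [^]\<^bsub>Delta238\<^esub> (4::nat) = \<one>\<^bsub>Delta238\<^esub>"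
    using yx D.nat_pow_pow[of "gy \<otimes>\<^bsub>Delta238\<^esub> gx" 2 4] by simp
  note lift = triangle_lift[OF group_Delta238 Delta_gens_closed(2) b Delta238_relations(2) b3 ab4]
  show "Delta_embedding \<in> hom Delta334 Delta238"
    unfolding Delta_embedding_def Delta334_def by (rule lift)
  show "Delta_embedding g\<alpha> = gy"
    unfolding Delta_embedding_def g\<alpha>_def by (rule lift)
  show "Delta_embedding g\<beta> = ?b"
    unfolding Delta_embedding_def g\<beta>_def by (rule lift)
qed

definition Delta_swap :: "tri_gen free_elem set \<Rightarrow> tri_gen free_elem set" where
  "Delta_swap = presented_lift Delta334 (case_tri_gen g\<beta> g\<alpha>)"

lemma Delta_swap:
  shows Delta_swap_hom: "Delta_swap \<in> hom Delta334 Delta334"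
    and Delta_swap_alpha: "Delta_swap g\<alpha> = g\<beta>"
    and Delta_swap_beta: "Delta_swap g\<beta> = g\<alpha>"
proof -
  have ba: "(g\<beta> \<otimes>\<^bsub>Delta334\<^esub> g\<alpha>) [^]\<^bsub>Delta334\<^esub> (4::nat) = \<one>\<^bsub>Delta334\<^esub>"
    by (rule E.swap_pow) (simp_all add: Delta334_relations)
  note lift = triangle_lift[OF group_Delta334 Delta_gens_closed(4,3)
      Delta334_relations(2,1) ba]
  show "Delta_swap \<in> hom Delta334 Delta334"
    unfolding Delta_swap_def by (subst (1) Delta334_def) (rule lift)
  show "Delta_swap g\<alpha> = g\<beta>"
    unfolding Delta_swap_def by (subst (1) g\<alpha>_def) (rule lift)
  show "Delta_swap g\<beta> = g\<alpha>"
    unfolding Delta_swap_def by (subst (1) g\<beta>_def) (rule lift)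
qed

lemma Delta334_hom_eqI:
  assumes "group H" "g \<in> hom Delta334 H" "h \<in> hom Delta334 H"
    and "g g\<alpha> = h g\<alpha>" "g g\<beta> = h g\<beta>" and "C \<in> carrier Delta334"
  shows "g C = h C"
  using assms(4,5)
  by (intro triangle_hom_eqI[OF assms(1) assms(2,3)[unfolded Delta334_def] _ _
        assms(6)[unfolded Delta334_def]]) (simp_all add: g\<alpha>_def g\<beta>_def)

lemma Delta_swap_swap:
  assumes "C \<in> carrier Delta334"
  shows "Delta_swap (Delta_swap C) = C"
proof -
  have id: "(\<lambda>u. u) \<in> hom Delta334 Delta334" by (auto simp: hom_def)
  have "(Delta_swap \<circ> Delta_swap) C = C"
    by (rule Delta334_hom_eqI[OF group_Delta334 hom_compose[OF Delta_swap_hom Delta_swap_hom] id _ _ assms])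
      (simp_all add: Delta_swap_alpha Delta_swap_beta)
  thus ?thesis by simp
qed

lemma Delta_swap_closed [simp]: "C \<in> carrier Delta334 \<Longrightarrow> Delta_swap C \<in> carrier Delta334"
  by (rule hom_in_carrier[OF Delta_swap_hom])

text \<open>
  Injectivity: the extension of \<open>\<Delta>(3,3,4)\<close> by the automorphism swapping the two generators is
  a semidirect product into which \<open>\<Delta>(2,3,8)\<close> maps, and the composition with
  \<open>Delta_embedding\<close> is the inclusion of the first factor.
\<close>

lemma Delta_embedding_inj: "inj_on Delta_embedding (carrier Delta334)"
proof -
  define K :: "(tri_gen free_elem set \<times> bool) monoid" where
    "K = \<lparr>carrier = carrier Delta334 \<times> UNIV,
          mult = (\<lambda>u v. (fst u \<otimes>\<^bsub>Delta334\<^esub> (if snd u then Delta_swap (fst v) else fst v),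
                         snd u \<noteq> snd v)),
          one = (\<one>\<^bsub>Delta334\<^esub>, False)\<rparr>"
  note sw_mult = hom_mult[OF Delta_swap_hom]
  note sw_one = hom_one[OF Delta_swap_hom group_Delta334 group_Delta334]
  have K: "group K"
  proof (rule groupI)
    fix u v w assume "u \<in> carrier K" "v \<in> carrier K" "w \<in> carrier K"
    thus "u \<otimes>\<^bsub>K\<^esub> v \<otimes>\<^bsub>K\<^esub> w = u \<otimes>\<^bsub>K\<^esub> (v \<otimes>\<^bsub>K\<^esub> w)"
      by (auto simp: K_def sw_mult Delta_swap_swap E.m_assoc)
  next
    fix u assume u: "u \<in> carrier K"
    let ?i = "inv\<^bsub>Delta334\<^esub> (fst u)"
    let ?v = "(if snd u then Delta_swap ?i else ?i, snd u)"
    have "?v \<otimes>\<^bsub>K\<^esub> u = \<one>\<^bsub>K\<^esub>"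
      using u by (auto simp: K_def sw_one simp flip: sw_mult)
    moreover have "?v \<in> carrier K" using u by (auto simp: K_def)
    ultimately show "\<exists>v\<in>carrier K. v \<otimes>\<^bsub>K\<^esub> u = \<one>\<^bsub>K\<^esub>" by blast
  qed (auto simp: K_def)
  interpret K: group K by (rule K)
  let ?x = "(\<one>\<^bsub>Delta334\<^esub>, True)" and ?y = "(g\<alpha>, False)"
  have in_hom: "(\<lambda>g. (g, False)) \<in> hom Delta334 K"
    by (auto simp: hom_def K_def)
  have pow: "(g, False) [^]\<^bsub>K\<^esub> (n::nat) = (g [^]\<^bsub>Delta334\<^esub> n, False)"
    if "g \<in> carrier Delta334" for g n
    using hom_nat_pow[OF in_hom that group_Delta334 K, of n] by simp
  have K1: "\<one>\<^bsub>K\<^esub> = (\<one>\<^bsub>Delta334\<^esub>, False)" by (simp add: K_def)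
  have x: "?x \<in> carrier K" and y: "?y \<in> carrier K" by (simp_all add: K_def)
  have x2: "?x [^]\<^bsub>K\<^esub> (2::nat) = \<one>\<^bsub>K\<^esub>"
    using K.l_one[OF x] by (simp add: numeral_2_eq_2) (simp add: K_def sw_one)
  have y3: "?y [^]\<^bsub>K\<^esub> (3::nat) = \<one>\<^bsub>K\<^esub>"
    by (simp add: pow Delta334_relations K1)
  have xy: "(?x \<otimes>\<^bsub>K\<^esub> ?y) \<in> carrier K" using x y by (rule K.m_closed)
  have "(?x \<otimes>\<^bsub>K\<^esub> ?y) [^]\<^bsub>K\<^esub> (2::nat) = (?x \<otimes>\<^bsub>K\<^esub> ?y) \<otimes>\<^bsub>K\<^esub> (?x \<otimes>\<^bsub>K\<^esub> ?y)"
    using K.l_one[OF xy] by (simp add: numeral_2_eq_2)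
  also have "\<dots> = (g\<beta> \<otimes>\<^bsub>Delta334\<^esub> g\<alpha>, False)"
    by (simp add: K_def Delta_swap_alpha Delta_swap_beta)
  finally have "((?x \<otimes>\<^bsub>K\<^esub> ?y) [^]\<^bsub>K\<^esub> (2::nat)) [^]\<^bsub>K\<^esub> (4::nat) = \<one>\<^bsub>K\<^esub>"
    by (simp add: pow K1 E.swap_pow Delta334_relations)
  hence xy8: "(?x \<otimes>\<^bsub>K\<^esub> ?y) [^]\<^bsub>K\<^esub> (8::nat) = \<one>\<^bsub>K\<^esub>"
    using K.nat_pow_pow[OF xy, of 2 4] by simp
  define \<Psi> where "\<Psi> = presented_lift K (case_tri_gen ?x ?y)"
  note lift = triangle_lift[OF K x y x2 y3 xy8, folded \<Psi>_def, folded Delta238_def gx_def gy_def]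
  have e: "\<Psi> (gx \<otimes>\<^bsub>Delta238\<^esub> gy \<otimes>\<^bsub>Delta238\<^esub> gx) = (g\<beta>, False)"
    by (simp add: hom_mult[OF lift(1)] lift(2,3))
      (simp add: K_def Delta_swap_alpha sw_one)
  have "(\<Psi> \<circ> Delta_embedding) C = (C, False)" if "C \<in> carrier Delta334" for C
    by (rule Delta334_hom_eqI[OF K hom_compose[OF Delta_embedding_hom lift(1)] in_hom _ _ that])
      (simp_all add: Delta_embedding_alpha Delta_embedding_beta lift(3) e)
  thus ?thesis by (intro inj_onI) (metis comp_apply fst_conv)
qed

lemma Bolza_group_normal: "Bolza_group \<lhd> Delta334"
  unfolding Bolza_group_def by (rule E.normal_closure_normal) auto

lemma Bolza_group_swap:
  assumes "b \<in> Bolza_group"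
  shows "Delta_swap b \<in> Bolza_group"
proof -
  interpret B: normal Bolza_group Delta334 by (rule Bolza_group_normal)
  interpret sw: group_hom Delta334 Delta334 Delta_swap
    using Delta_swap_hom by (simp add: group_hom_def group_hom_axioms_def group_Delta334)
  let ?N = "{c \<in> carrier Delta334. Delta_swap c \<in> Bolza_group}"
  let ?p = "g\<alpha> \<otimes>\<^bsub>Delta334\<^esub> g\<beta>" and ?q = "g\<beta> \<otimes>\<^bsub>Delta334\<^esub> g\<alpha>"
  let ?w = "?p [^]\<^bsub>Delta334\<^esub> (2::nat) \<otimes>\<^bsub>Delta334\<^esub>
     (g\<alpha> [^]\<^bsub>Delta334\<^esub> (2::nat) \<otimes>\<^bsub>Delta334\<^esub> g\<beta> [^]\<^bsub>Delta334\<^esub> (2::nat)) [^]\<^bsub>Delta334\<^esub> (2::nat)"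
  have N: "?N \<lhd> Delta334"
  proof (rule E.normal_invI)
    show "subgroup ?N Delta334"
      by (rule E.subgroupI) (auto intro!: exI[of _ "\<one>\<^bsub>Delta334\<^esub>"])
    fix x h assume "x \<in> carrier Delta334" "h \<in> ?N"
    thus "x \<otimes>\<^bsub>Delta334\<^esub> h \<otimes>\<^bsub>Delta334\<^esub> inv\<^bsub>Delta334\<^esub> x \<in> ?N"
      by (auto intro: B.inv_op_closed2)
  qed
  have cube: "g [^]\<^bsub>Delta334\<^esub> (2::nat) = inv\<^bsub>Delta334\<^esub> g"
    if "g \<in> carrier Delta334" "g [^]\<^bsub>Delta334\<^esub> (3::nat) = \<one>\<^bsub>Delta334\<^esub>" for g
    using that by (intro E.inv_equality[symmetric]) (simp_all add: numeral_3_eq_3 numeral_2_eq_2)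
  have a2: "g\<alpha> [^]\<^bsub>Delta334\<^esub> (2::nat) = inv\<^bsub>Delta334\<^esub> g\<alpha>"
    and b2: "g\<beta> [^]\<^bsub>Delta334\<^esub> (2::nat) = inv\<^bsub>Delta334\<^esub> g\<beta>"
    by (rule cube; simp add: Delta334_relations)+
  have w: "?w = ?p [^]\<^bsub>Delta334\<^esub> (2::nat) \<otimes>\<^bsub>Delta334\<^esub> inv\<^bsub>Delta334\<^esub> (?q [^]\<^bsub>Delta334\<^esub> (2::nat))"
    by (simp add: a2 b2 E.inv_mult_group[symmetric] E.nat_pow_inv)
  have "Delta_swap ?w
      = ?q [^]\<^bsub>Delta334\<^esub> (2::nat) \<otimes>\<^bsub>Delta334\<^esub> inv\<^bsub>Delta334\<^esub> (?p [^]\<^bsub>Delta334\<^esub> (2::nat))"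
    unfolding w by (simp add: sw.hom_nat_pow Delta_swap_alpha Delta_swap_beta)
  also have "\<dots> = inv\<^bsub>Delta334\<^esub> ?w"
    unfolding w by (simp add: E.inv_mult_group)
  also have "\<dots> \<in> Bolza_group"
    using subset_normal_closure[of "{?w}" Delta334] by (simp add: Bolza_group_def[symmetric])
  finally have "?w \<in> ?N" by simp
  hence "normal_closure Delta334 {?w} \<subseteq> ?N"
    by (intro normal_closure_least[OF N]) simp
  moreover have "b \<in> normal_closure Delta334 {?w}"
    by (rule assms[unfolded Bolza_group_def])
  ultimately have "b \<in> ?N" by (rule subsetD)
  thus ?thesis by simp
qed

text \<open>Hence the quotient of \<open>\<Delta>(2,3,8)\<close> by the image of the Bolza group is a group.\<close>

lemma Bolza_group_normal_Delta238: "Delta_embedding ` Bolza_group \<lhd> Delta238"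
proof -
  interpret B: normal Bolza_group Delta334 by (rule Bolza_group_normal)
  interpret e: group_hom Delta334 Delta238 Delta_embedding
    using Delta_embedding_hom
    by (simp add: group_hom_def group_hom_axioms_def group_Delta334 group_Delta238)
  let ?K = "Delta_embedding ` Bolza_group"
  let ?c = "\<lambda>g k. g \<otimes>\<^bsub>Delta238\<^esub> k \<otimes>\<^bsub>Delta238\<^esub> inv\<^bsub>Delta238\<^esub> g"
  let ?N = "{g \<in> carrier Delta238. \<forall>k\<in>?K. ?c g k \<in> ?K \<and> ?c (inv\<^bsub>Delta238\<^esub> g) k \<in> ?K}"
  have K: "subgroup ?K Delta238"
    by (rule e.subgroup_img_is_subgroup[OF B.is_subgroup])
  have Kc: "k \<in> carrier Delta238" if "k \<in> ?K" for k
    using that subgroup.mem_carrier[OF K] by blast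
  have cc: "?c (g \<otimes>\<^bsub>Delta238\<^esub> h) k = ?c g (?c h k)"
    if "g \<in> carrier Delta238" "h \<in> carrier Delta238" "k \<in> carrier Delta238" for g h k
    using that by (simp add: D.inv_mult_group D.m_assoc)
  have N: "subgroup ?N Delta238"
  proof (rule D.subgroupI)
    show "?N \<noteq> {}"
      using Kc by (auto intro!: exI[of _ "\<one>\<^bsub>Delta238\<^esub>"])
    fix g h assume g: "g \<in> ?N" and h: "h \<in> ?N"
    show "inv\<^bsub>Delta238\<^esub> g \<in> ?N" using g by auto
    have gc: "g \<in> carrier Delta238" and hc: "h \<in> carrier Delta238"
      using g h by auto
    have gK: "?c g k \<in> ?K" "?c (inv\<^bsub>Delta238\<^esub> g) k \<in> ?K" if "k \<in> ?K" for k
      using g that by blast+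
    have hK: "?c h k \<in> ?K" "?c (inv\<^bsub>Delta238\<^esub> h) k \<in> ?K" if "k \<in> ?K" for k
      using h that by blast+
    have "?c (g \<otimes>\<^bsub>Delta238\<^esub> h) k \<in> ?K" if k: "k \<in> ?K" for k
      by (subst cc[OF gc hc Kc[OF k]]) (rule gK(1)[OF hK(1)[OF k]])
    moreover have "?c (inv\<^bsub>Delta238\<^esub> (g \<otimes>\<^bsub>Delta238\<^esub> h)) k \<in> ?K" if k: "k \<in> ?K" for k
      unfolding D.inv_mult_group[OF gc hc] cc[OF D.inv_closed[OF hc] D.inv_closed[OF gc] Kc[OF k]]
      by (rule hK(2)[OF gK(2)[OF k]])
    ultimately show "g \<otimes>\<^bsub>Delta238\<^esub> h \<in> ?N" using gc hc by blast
  qed auto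
  have conj_hom: "(\<lambda>k. ?c gx k) \<in> hom Delta238 Delta238"
  proof (rule homI)
    fix g h assume "g \<in> carrier Delta238" "h \<in> carrier Delta238"
    thus "?c gx (g \<otimes>\<^bsub>Delta238\<^esub> h) = ?c gx g \<otimes>\<^bsub>Delta238\<^esub> ?c gx h"
      by (intro D.conj_mult) simp_all
  qed simp
  have cx: "?c gx (Delta_embedding b) = Delta_embedding (Delta_swap b)"
    if "b \<in> carrier Delta334" for b
  proof -
    have "((\<lambda>k. ?c gx k) \<circ> Delta_embedding) b = (Delta_embedding \<circ> Delta_swap) b"
    proof (rule Delta334_hom_eqI[OF group_Delta238 hom_compose[OF Delta_embedding_hom conj_hom]
            hom_compose[OF Delta_swap_hom Delta_embedding_hom] _ _ that])
      show "((\<lambda>k. ?c gx k) \<circ> Delta_embedding) g\<alpha> = (Delta_embedding \<circ> Delta_swap) g\<alpha>"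
        by (simp add: Delta_embedding_alpha Delta_embedding_beta Delta_swap_alpha inv_gx)
      have "gx \<otimes>\<^bsub>Delta238\<^esub> (gx \<otimes>\<^bsub>Delta238\<^esub> gy \<otimes>\<^bsub>Delta238\<^esub> gx) \<otimes>\<^bsub>Delta238\<^esub> gx
          = (gx \<otimes>\<^bsub>Delta238\<^esub> gx) \<otimes>\<^bsub>Delta238\<^esub> gy \<otimes>\<^bsub>Delta238\<^esub> (gx \<otimes>\<^bsub>Delta238\<^esub> gx)"
        by (simp only: D.m_assoc D.m_closed Delta_gens_closed)
      thus "((\<lambda>k. ?c gx k) \<circ> Delta_embedding) g\<beta> = (Delta_embedding \<circ> Delta_swap) g\<beta>"
        by (simp add: Delta_embedding_alpha Delta_embedding_beta Delta_swap_beta inv_gx gx_square)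
    qed
    thus ?thesis by simp
  qed
  have "gx \<in> ?N"
    using cx Bolza_group_swap B.subset by (auto simp: inv_gx)
  moreover have "gy \<in> ?N"
  proof -
    have "?c gy k \<in> ?K \<and> ?c (inv\<^bsub>Delta238\<^esub> gy) k \<in> ?K" if kK: "k \<in> ?K" for k
    proof -
      from kK obtain b where k: "k = Delta_embedding b" and b: "b \<in> Bolza_group"
        by (rule imageE)
      have "?c gy k = Delta_embedding (g\<alpha> \<otimes>\<^bsub>Delta334\<^esub> b \<otimes>\<^bsub>Delta334\<^esub> inv\<^bsub>Delta334\<^esub> g\<alpha>)"
        using B.mem_carrier[OF b] by (simp add: k Delta_embedding_alpha)
      moreover have "?c (inv\<^bsub>Delta238\<^esub> gy) k
          = Delta_embedding (inv\<^bsub>Delta334\<^esub> g\<alpha> \<otimes>\<^bsub>Delta334\<^esub> b \<otimes>\<^bsub>Delta334\<^esub> g\<alpha>)"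
        using B.mem_carrier[OF b] by (simp add: k Delta_embedding_alpha)
      ultimately show ?thesis
        using B.inv_op_closed1[of "g\<alpha>" b] B.inv_op_closed2[of "g\<alpha>" b] b
        by (metis Delta_gens_closed(3) imageI)
    qed
    thus ?thesis by simp
  qed
  ultimately have "presented_gen (triangle_relators 2 3 8) t \<in> ?N" for t
    by (cases t) (simp_all only: gx_def gy_def)
  hence "?N = carrier Delta238"
    using N unfolding Delta238_def triangle_group_def by (intro presented_group_generated)
  thus ?thesis
    using K by (intro D.normal_invI) blast+
qed


section \<open>General linear groups\<close>

definition GL :: "('a::comm_ring_1 ^ 'n ^ 'n) monoid" where
  "GL = \<lparr>carrier = {A. invertible A}, mult = (**), one = mat 1\<rparr>"

lemma group_GL: "group GL"
  by (rule groupI) (auto simp: GL_def invertible_mult matrix_mul_assoc invertible_def[of "mat 1"],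
    auto simp: invertible_def)

text \<open>The numeral type \<open>3\<close> is the ring of integers modulo 3, i.e. the field with three elements.\<close>

lemma three_field:
  fixes a :: 3
  assumes "a \<noteq> 0"
  shows "\<exists>b. a * b = 1"
proof (cases a)
  case (of_int z)
  hence "z = 1 \<or> z = 2" using assms by (cases "z = 0") auto
  moreover have "(2 :: 3) * 2 = 1" by simp
  ultimately show ?thesis using of_int by (metis mult_1 of_int_1 of_int_numeral)
qed

end

theory Submission
  imports Defs
begin

text \<open>
  Write \<open>c = xy\<close>, so that \<open>\<Delta>(2,3,8)\<close> is generated by \<open>x\<close> and \<open>c\<close>, and \<open>y = xc\<close>. In these
  terms the embedded relator of the Bolza group is \<open>(yx)\<^sup>4 c\<^sup>-\<^sup>4\<close>. As \<open>yx\<close> is the conjugate of \<open>c\<close> by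
  \<open>x\<close>, killing it means exactly making \<open>c\<^sup>4\<close> commute with \<open>x\<close>, hence central. Modulo \<open>c\<^sup>4\<close> what
  remains is the \<open>(2,3,4)\<close> triangle group, that is, the rotation group of the cube, with \<open>c\<close> a
  quarter turn. So the quotient has order at most 48.

  This bound is used in the form that the cyclic group generated by \<open>c\<close> has at most six cosets, one
  for each face of the cube, with explicit representatives (lemma \<open>six_cosets\<close>).

  On the other side, \<open>x\<close> and \<open>y\<close> are sent to the matrices that swap the coordinates and shear the
  plane over the field with three elements; \<open>c\<close> then goes to the Fibonacci matrix, whose order
  modulo 3 is 8 and whose fourth power is \<open>-1\<close>. This defines the homomorphism \<open>to_GL\<close>, which
  kills the Bolza group because \<open>-1\<close> is central.

  \<^item> It is onto (lemma \<open>GL_generated\<close>): the powers of the Fibonacci matrix carry any nonzero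
    vector to the first basis vector, and the stabilizer of that vector consists of six
    triangular matrices, which are written down as words.

  \<^item> Its kernel is no larger than the Bolza group (lemma \<open>kernel_subset_Bolza_group\<close>): write an
    element as \<open>t c\<^sup>j\<close> modulo the Bolza group, with \<open>t\<close> one of the six representatives. If it is
    mapped to 1, then the image of \<open>t\<close> is a power of the Fibonacci matrix, so commutes with it;
    among the six matrices only the identity does. So \<open>t = 1\<close>, and then 8 divides \<open>j\<close>.

  The first isomorphism theorem concludes. Neither group has to be counted.
\<close>

section \<open>Commutation in groups\<close>

lemma (in group) commute_if_mult_pow_eq_one:
  assumes a: "a \<in> carrier G" and b: "b \<in> carrier G" and ab: "a \<otimes> b [^] (j::nat) = \<one>"
  shows "a \<otimes> b = b \<otimes> a"
proof -
  have "b [^] j \<otimes> a = \<one>" using a b ab by (simp add: inv_comm)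
  hence "a \<otimes> b = a \<otimes> b \<otimes> (b [^] j \<otimes> a)" using a b by simp
  also have "\<dots> = a \<otimes> (b \<otimes> b [^] j) \<otimes> a" using a b by (simp add: m_assoc)
  also have "b \<otimes> b [^] j = b [^] j \<otimes> b" using b by (simp add: nat_pow_Suc2[symmetric])
  also have "a \<otimes> (b [^] j \<otimes> b) \<otimes> a = b \<otimes> a" using a b ab by (simp add: m_assoc[symmetric])
  finally show ?thesis .
qed

lemma (in group) mult_pow_swap:
  assumes "a \<in> carrier G" "b \<in> carrier G"
  shows "a \<otimes> (b \<otimes> a) [^] (n::nat) = (a \<otimes> b) [^] n \<otimes> a"
proof (induction n)
  case (Suc n)
  have "a \<otimes> (b \<otimes> a) [^] Suc n = (a \<otimes> (b \<otimes> a) [^] n) \<otimes> (b \<otimes> a)"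
    using assms by (simp add: m_assoc)
  thus ?case using assms by (simp add: Suc.IH m_assoc)
qed (use assms in simp)

section \<open>A group covered by six cosets of a cyclic subgroup\<close>

text \<open>
  The relations that hold in \<open>\<Delta>(2,3,8)\<close> modulo the Bolza group, in terms of \<open>x\<close> and \<open>c = xy\<close>.
\<close>

locale central_fourth_power = group +
  fixes x c
  assumes x: "x \<in> carrier G" and c: "c \<in> carrier G"
    and x2: "x \<otimes> x = \<one>" and xc3: "(x \<otimes> c) [^] (3::nat) = \<one>" and c8: "c [^] (8::nat) = \<one>"
    and c4x: "c [^] (4::nat) \<otimes> x = x \<otimes> c [^] (4::nat)"
begin

text \<open>The relation \<open>y\<^sup>3 = 1\<close>, solved for \<open>xcx\<close> with the help of the central element \<open>c\<^sup>4\<close>.\<close>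

lemma xcx: "x \<otimes> c \<otimes> x = c [^] (3::nat) \<otimes> x \<otimes> c [^] (3::nat)"
proof -
  have "c \<otimes> (x \<otimes> c \<otimes> x) \<otimes> c = x \<otimes> (x \<otimes> c) [^] (3::nat)"
    using x c by (simp add: numeral_3_eq_3 m_assoc[symmetric] x2)
  hence "c \<otimes> (x \<otimes> c \<otimes> x) \<otimes> c = x" using x xc3 by simp
  moreover have "c \<otimes> (c [^] (3::nat) \<otimes> x \<otimes> c [^] (3::nat)) \<otimes> c = c [^] (4::nat) \<otimes> x \<otimes> c [^] (4::nat)"
    using x c by (simp add: numeral_eq_Suc m_assoc nat_pow_Suc2)
  moreover have "\<dots> = x" using x c c8 c4x by (simp add: m_assoc nat_pow_mult)
  ultimately have "c \<otimes> (x \<otimes> c \<otimes> x) \<otimes> c = c \<otimes> (c [^] (3::nat) \<otimes> x \<otimes> c [^] (3::nat)) \<otimes> c"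
    by (simp only:)
  thus ?thesis using x c by (simp only: right_cancel Units_l_cancel Units_eq m_closed nat_pow_closed)
qed

text \<open>
  Think of \<open>c\<close> as a quarter turn of a cube about a base face, and of \<open>x\<close> as the half turn that
  exchanges the base face with a neighbour. The representatives carry the base face to itself, to
  its four neighbours, and to the opposite face, in this order.
\<close>

definition reps :: "'a set" where
  "reps = {\<one>, x, c \<otimes> x, c [^] (2::nat) \<otimes> x, c [^] (3::nat) \<otimes> x, x \<otimes> c [^] (2::nat) \<otimes> x}"

lemma reps_closed: "r \<in> reps \<Longrightarrow> r \<in> carrier G"
  using x c by (auto simp: reps_def)

lemma c4x': "c [^] (4::nat) \<otimes> (x \<otimes> g) = x \<otimes> (c [^] (4::nat) \<otimes> g)" if "g \<in> carrier G"
  using that x c arg_cong[OF c4x, of "\<lambda>h. h \<otimes> g"] by (simp add: m_assoc)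

lemma cc: "c [^] (i::nat) \<otimes> (c [^] (j::nat) \<otimes> g) = c [^] (i + j) \<otimes> g" if "g \<in> carrier G" for i j
  using that c by (simp add: nat_pow_mult[symmetric] m_assoc)

text \<open>
  The six left cosets of \<open>\<langle>c\<rangle>\<close> are permuted by \<open>x\<close>, and likewise by \<open>c\<close> in the lemma after this
  one. Here \<open>x\<close> exchanges the base face with the neighbour \<open>x\<close>, the neighbours \<open>cx\<close> and \<open>c\<^sup>3x\<close>,
  and the neighbour \<open>c\<^sup>2x\<close> with the opposite face.
\<close>

lemma x_reps:
  assumes "r \<in> reps"
  shows "\<exists>s\<in>reps. \<exists>j::nat. x \<otimes> r = s \<otimes> c [^] j"
proof -
  have xc3x: "x \<otimes> (c [^] (3::nat) \<otimes> x) = c \<otimes> x \<otimes> c [^] (5::nat)"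
  proof -
    have "c \<otimes> x = x \<otimes> (c [^] (3::nat) \<otimes> x) \<otimes> c [^] (3::nat)"
      using x c x2 arg_cong[OF xcx, of "\<lambda>h. x \<otimes> h"] by (simp add: m_assoc[symmetric])
    hence "c \<otimes> x \<otimes> c [^] (5::nat) = x \<otimes> (c [^] (3::nat) \<otimes> x) \<otimes> c [^] (8::nat)"
      using x c by (simp add: m_assoc nat_pow_mult)
    thus ?thesis using x c c8 by simp
  qed
  have xx: "x \<otimes> (x \<otimes> g) = g" if "g \<in> carrier G" for g
    using that x x2 by (simp add: m_assoc[symmetric])
  from assms consider "r = \<one>" | "r = x" | "r = c \<otimes> x" | "r = c [^] (2::nat) \<otimes> x"
    | "r = c [^] (3::nat) \<otimes> x" | "r = x \<otimes> c [^] (2::nat) \<otimes> x"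
    by (auto simp: reps_def)
  thus ?thesis
  proof cases
    case 1
    hence "x \<otimes> r = x \<otimes> c [^] (0::nat)" using x by simp
    thus ?thesis unfolding reps_def by blast
  next
    case 2
    hence "x \<otimes> r = \<one> \<otimes> c [^] (0::nat)" using x2 by simp
    thus ?thesis unfolding reps_def by blast
  next
    case 3
    hence "x \<otimes> r = (c [^] (3::nat) \<otimes> x) \<otimes> c [^] (3::nat)" using x c xcx by (simp add: m_assoc)
    thus ?thesis unfolding reps_def by blast
  next
    case 4
    hence "x \<otimes> r = (x \<otimes> c [^] (2::nat) \<otimes> x) \<otimes> c [^] (0::nat)" using x c by (simp add: m_assoc)
    thus ?thesis unfolding reps_def by blast
  next
    case 5
    hence "x \<otimes> r = (c \<otimes> x) \<otimes> c [^] (5::nat)" using x c xc3x by simp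
    thus ?thesis unfolding reps_def by blast
  next
    case 6
    hence "x \<otimes> r = (c [^] (2::nat) \<otimes> x) \<otimes> c [^] (0::nat)" using x c by (simp add: m_assoc xx)
    thus ?thesis unfolding reps_def by blast
  qed
qed

lemma c_reps:
  assumes "r \<in> reps"
  shows "\<exists>s\<in>reps. \<exists>j::nat. c \<otimes> r = s \<otimes> c [^] j"
proof -
  have c1: "c \<otimes> (c [^] n \<otimes> g) = c [^] (Suc n) \<otimes> g" if "g \<in> carrier G" for g and n :: nat
    using that c by (simp only: nat_pow_Suc2 m_assoc nat_pow_closed)
  have c42: "c [^] (4::nat) \<otimes> (c [^] (2::nat) \<otimes> g) = c [^] (2::nat) \<otimes> (c [^] (4::nat) \<otimes> g)"
    if "g \<in> carrier G" for g
    using that by (simp add: cc)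
  have xc2x: "c \<otimes> (x \<otimes> c [^] (2::nat) \<otimes> x) = x \<otimes> c [^] (2::nat) \<otimes> x \<otimes> c [^] (3::nat)"
  proof -
    have "x \<otimes> c [^] (2::nat) \<otimes> x = (x \<otimes> c \<otimes> x) \<otimes> (x \<otimes> c \<otimes> x)"
    proof -
      have "(x \<otimes> c \<otimes> x) \<otimes> (x \<otimes> c \<otimes> x) = x \<otimes> c \<otimes> (x \<otimes> x) \<otimes> c \<otimes> x"
        using x c by (simp only: m_assoc m_closed)
      thus ?thesis using x c x2 by (simp add: numeral_2_eq_2 m_assoc)
    qed
    also have "\<dots> = c [^] (3::nat) \<otimes> x \<otimes> (c [^] (3::nat) \<otimes> c [^] (3::nat)) \<otimes> x \<otimes> c [^] (3::nat)"
      unfolding xcx using x c by (simp only: m_assoc m_closed nat_pow_closed)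
    also have "c [^] (3::nat) \<otimes> c [^] (3::nat) = c [^] (2::nat) \<otimes> c [^] (4::nat)"
      using c by (simp add: nat_pow_mult)
    also have "c [^] (3::nat) \<otimes> x \<otimes> (c [^] (2::nat) \<otimes> c [^] (4::nat)) \<otimes> x \<otimes> c [^] (3::nat)
      = c [^] (3::nat) \<otimes> (x \<otimes> c [^] (2::nat) \<otimes> x) \<otimes> c [^] (7::nat)"
      using x c nat_pow_mult[OF c, of 4 3] by (simp add: m_assoc c4x')
    finally have "c \<otimes> (x \<otimes> c [^] (2::nat) \<otimes> x) =
      c \<otimes> (c [^] (3::nat) \<otimes> (x \<otimes> c [^] (2::nat) \<otimes> x) \<otimes> c [^] (7::nat))" by simp
    also have "\<dots> = c [^] (4::nat) \<otimes> (x \<otimes> c [^] (2::nat) \<otimes> x) \<otimes> c [^] (7::nat)"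
      using x c by (simp add: m_assoc c1)
    also have "\<dots> = x \<otimes> (c [^] (2::nat) \<otimes> (c [^] (4::nat) \<otimes> (x \<otimes> c [^] (7::nat))))"
      using x c by (simp add: m_assoc c4x' c42)
    also have "\<dots> = x \<otimes> c [^] (2::nat) \<otimes> x \<otimes> (c [^] (8::nat) \<otimes> c [^] (3::nat))"
      using x c by (simp add: c4x' m_assoc nat_pow_mult)
    finally show ?thesis using x c c8 by simp
  qed
  from assms consider "r = \<one>" | "r = x" | "r = c \<otimes> x" | "r = c [^] (2::nat) \<otimes> x"
    | "r = c [^] (3::nat) \<otimes> x" | "r = x \<otimes> c [^] (2::nat) \<otimes> x"
    by (auto simp: reps_def)
  thus ?thesis
  proof cases
    case 1
    hence "c \<otimes> r = \<one> \<otimes> c [^] (1::nat)" using c by simp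
    thus ?thesis unfolding reps_def by blast
  next
    case 2
    hence "c \<otimes> r = (c \<otimes> x) \<otimes> c [^] (0::nat)" using x c by simp
    thus ?thesis unfolding reps_def by blast
  next
    case 3
    hence "c \<otimes> r = (c [^] (2::nat) \<otimes> x) \<otimes> c [^] (0::nat)"
      using x c by (simp add: numeral_2_eq_2 m_assoc)
    thus ?thesis unfolding reps_def by blast
  next
    case 4
    hence "c \<otimes> r = (c [^] (3::nat) \<otimes> x) \<otimes> c [^] (0::nat)"
      using x c by (simp add: c1 numeral_3_eq_3 numeral_2_eq_2 m_assoc)
    thus ?thesis unfolding reps_def by blast
  next
    case 5
    have "c \<otimes> r = c [^] (4::nat) \<otimes> x" using x c 5 by (simp add: c1 del: nat_pow_Suc)
    hence "c \<otimes> r = x \<otimes> c [^] (4::nat)" using c4x by simp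
    thus ?thesis unfolding reps_def by blast
  next
    case 6
    hence "c \<otimes> r = (x \<otimes> c [^] (2::nat) \<otimes> x) \<otimes> c [^] (3::nat)" using xc2x by simp
    thus ?thesis unfolding reps_def by blast
  qed
qed

text \<open>
  The union of the six cosets contains 1 and is stable under \<open>x\<close> and \<open>c\<close>, so it is everything. As
  the elements that map the union into itself form a priori only a submonoid, their inverses are
  asked to do the same; the inverses of \<open>x\<close> and \<open>c\<close> are powers, so nothing is lost.
\<close>

lemma six_cosets:
  assumes gen: "\<And>H. subgroup H G \<Longrightarrow> x \<in> H \<Longrightarrow> c \<in> H \<Longrightarrow> H = carrier G"
    and g: "g \<in> carrier G"
  shows "\<exists>r\<in>reps. \<exists>j::nat. g = r \<otimes> c [^] j"
proof -
  define S where "S = {r \<otimes> c [^] j | r j. r \<in> reps \<and> (j::nat) \<in> UNIV}"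
  let ?H = "{h \<in> carrier G. (\<forall>s\<in>S. h \<otimes> s \<in> S) \<and> (\<forall>s\<in>S. inv h \<otimes> s \<in> S)}"
  have S: "s \<in> carrier G" if "s \<in> S" for s using that c reps_closed by (auto simp: S_def)
  have stable: "h \<otimes> s \<in> S"
    if h: "h \<in> carrier G" "\<forall>r\<in>reps. \<exists>s\<in>reps. \<exists>j::nat. h \<otimes> r = s \<otimes> c [^] j"
      and "s \<in> S" for h s
  proof -
    obtain r j where rj: "r \<in> reps" "s = r \<otimes> c [^] (j::nat)" using \<open>s \<in> S\<close> by (auto simp: S_def)
    obtain r' i where "r' \<in> reps" "h \<otimes> r = r' \<otimes> c [^] (i::nat)" using h(2) rj(1) by blast
    moreover from this have "h \<otimes> s = r' \<otimes> c [^] (i + j)"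
      using rj h(1) c reps_closed by (metis m_assoc nat_pow_closed nat_pow_mult)
    ultimately show ?thesis by (auto simp: S_def)
  qed
  have "\<forall>r\<in>reps. \<exists>s\<in>reps. \<exists>j::nat. x \<otimes> r = s \<otimes> c [^] j"
    and "\<forall>r\<in>reps. \<exists>s\<in>reps. \<exists>j::nat. c \<otimes> r = s \<otimes> c [^] j"
    using x_reps c_reps by blast+
  note xS = stable[OF x this(1)] and cS = stable[OF c this(2)]
  have cnS: "c [^] (n::nat) \<otimes> s \<in> S" if "s \<in> S" for n s
  proof (induction n)
    case 0
    show ?case using S[OF that] that by simp
  next
    case (Suc n)
    have "c [^] Suc n \<otimes> s = c \<otimes> (c [^] n \<otimes> s)"
      using c S[OF that] by (simp only: nat_pow_Suc2 m_assoc nat_pow_closed)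
    thus ?case using cS[OF Suc.IH] by simp
  qed
  have "inv x = x" using x x2 by (simp add: inv_equality)
  hence xH: "x \<in> ?H" using x xS by simp
  have "inv c = c [^] (7::nat)"
    using c c8 nat_pow_mult[OF c, of 7 1] by (intro inv_equality) simp_all
  hence cH: "c \<in> ?H" using c cS cnS by simp
  have "subgroup ?H G"
  proof (rule subgroupI)
    show "?H \<noteq> {}" using xH by blast
    fix h k assume h: "h \<in> ?H" and k: "k \<in> ?H"
    show "inv h \<in> ?H" using h by simp
    have "h \<otimes> k \<otimes> s \<in> S" if s: "s \<in> S" for s
    proof -
      have "h \<otimes> (k \<otimes> s) \<in> S" using h k s by blast
      thus ?thesis using h k S[OF s] by (simp add: m_assoc)
    qed
    moreover have "inv (h \<otimes> k) \<otimes> s \<in> S" if s: "s \<in> S" for s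
    proof -
      have "inv k \<otimes> (inv h \<otimes> s) \<in> S" using h k s by blast
      thus ?thesis using h k S[OF s] by (simp add: m_assoc inv_mult_group)
    qed
    ultimately show "h \<otimes> k \<in> ?H" using h k by simp
  qed auto
  hence "?H = carrier G" using xH cH by (rule gen)
  hence "g \<in> ?H" using g by simp
  moreover have "\<one> \<otimes> c [^] (0::nat) \<in> S" unfolding S_def reps_def by blast
  ultimately have "g \<otimes> (\<one> \<otimes> c [^] (0::nat)) \<in> S" by blast
  thus ?thesis using g by (auto simp: S_def)
qed

end

section \<open>The general linear group of the plane over the field with three elements\<close>

definition mat2 :: "'a::comm_ring_1 \<Rightarrow> 'a \<Rightarrow> 'a \<Rightarrow> 'a \<Rightarrow> 'a ^ 2 ^ 2" where
  "mat2 a b c d = vector [vector [a, b], vector [c, d]]"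

lemma mat2_nth [simp]:
  "mat2 a b c d $ 1 $ 1 = a" "mat2 a b c d $ 1 $ 2 = b"
  "mat2 a b c d $ 2 $ 1 = c" "mat2 a b c d $ 2 $ 2 = d"
  by (simp_all add: mat2_def)

lemma mat2_cases:
  fixes A :: "'a::comm_ring_1 ^ 2 ^ 2"
  obtains a b c d where "A = mat2 a b c d"
proof -
  have "A = mat2 (A $ 1 $ 1) (A $ 1 $ 2) (A $ 2 $ 1) (A $ 2 $ 2)"
    by (simp add: vec_eq_iff forall_2)
  thus ?thesis by (rule that)
qed

lemma mat2_eq_iff [simp]: "mat2 a b c d = mat2 a' b' c' d' \<longleftrightarrow> a = a' \<and> b = b' \<and> c = c' \<and> d = d'"
  by (metis mat2_nth)

lemma mat2_mult [simp]:
  "mat2 a b c d ** mat2 a' b' c' d' = mat2 (a*a' + b*c') (a*b' + b*d') (c*a' + d*c') (c*b' + d*d')"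
  by (simp add: vec_eq_iff forall_2 matrix_matrix_mult_def sum_2)

lemma mat_1_mat2: "mat 1 = mat2 1 0 0 1"
  by (simp add: vec_eq_iff forall_2 mat_def)

lemma three_cases: "a = 0 \<or> a = 1 \<or> a = (2::3)"
proof (cases a)
  case (of_int z)
  hence "z = 0 \<or> z = 1 \<or> z = 2" by auto
  thus ?thesis using of_int by auto
qed

lemma GL_simps [simp]: "A \<otimes>\<^bsub>GL\<^esub> B = A ** B" "\<one>\<^bsub>GL\<^esub> = mat 1"
  by (simp_all add: GL_def)

abbreviation swap_mat :: "3 ^ 2 ^ 2" where "swap_mat \<equiv> mat2 0 1 1 0"
abbreviation shear_mat :: "3 ^ 2 ^ 2" where "shear_mat \<equiv> mat2 1 1 0 1"
abbreviation fib_mat :: "3 ^ 2 ^ 2" where "fib_mat \<equiv> mat2 0 1 1 1"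

interpretation GL: group "GL :: (3 ^ 2 ^ 2) monoid" by (rule group_GL)

lemma gens_in_GL [simp]: "swap_mat \<in> carrier GL" "shear_mat \<in> carrier GL" "fib_mat \<in> carrier GL"
proof -
  have "swap_mat ** swap_mat = mat 1" "shear_mat ** mat2 1 2 0 1 = mat 1"
    "mat2 1 2 0 1 ** shear_mat = mat 1" "fib_mat ** mat2 2 1 1 0 = mat 1"
    "mat2 2 1 1 0 ** fib_mat = mat 1"
    by (simp_all add: mat_1_mat2)
  thus "swap_mat \<in> carrier GL" "shear_mat \<in> carrier GL" "fib_mat \<in> carrier GL"
    unfolding GL_def invertible_def by (auto simp del: mat2_mult)
qed

text \<open>
  The entries are consecutive Fibonacci numbers modulo 3. The first columns of the eight powers
  are the eight nonzero vectors.
\<close>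

lemma fib_mat_pow:
  "fib_mat [^]\<^bsub>GL\<^esub> (0::nat) = mat2 1 0 0 1" "fib_mat [^]\<^bsub>GL\<^esub> (1::nat) = mat2 0 1 1 1"
  "fib_mat [^]\<^bsub>GL\<^esub> (2::nat) = mat2 1 1 1 2" "fib_mat [^]\<^bsub>GL\<^esub> (3::nat) = mat2 1 2 2 0"
  "fib_mat [^]\<^bsub>GL\<^esub> (4::nat) = mat2 2 0 0 2" "fib_mat [^]\<^bsub>GL\<^esub> (5::nat) = mat2 0 2 2 2"
  "fib_mat [^]\<^bsub>GL\<^esub> (6::nat) = mat2 2 2 2 1" "fib_mat [^]\<^bsub>GL\<^esub> (7::nat) = mat2 2 1 1 0"
  "fib_mat [^]\<^bsub>GL\<^esub> (8::nat) = mat2 1 0 0 1"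
  by (simp_all add: numeral_eq_Suc mat_1_mat2)

lemma fib_mat_pow_eq_1:
  assumes "fib_mat [^]\<^bsub>GL\<^esub> (j::nat) = mat 1"
  shows "8 dvd j"
proof -
  have "fib_mat [^]\<^bsub>GL\<^esub> (8 * (j div 8) + j mod 8) = fib_mat [^]\<^bsub>GL\<^esub> (j mod 8)"
    by (simp only: GL.nat_pow_mult[symmetric] GL.nat_pow_pow[symmetric] gens_in_GL fib_mat_pow
        mat_1_mat2[symmetric] GL_simps(2)[symmetric] GL.nat_pow_one GL.l_one GL.nat_pow_closed)
  hence "fib_mat [^]\<^bsub>GL\<^esub> (j mod 8) = mat2 1 0 0 1" using assms by (simp add: mat_1_mat2)
  moreover have "j mod 8 < 8" by simp
  hence "j mod 8 \<in> {0, 1, 2, 3, 4, 5, 6, 7}" by auto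
  ultimately have "j mod 8 = 0" using fib_mat_pow by auto
  thus ?thesis by auto
qed

text \<open>
  If the given column is the first column of the power \<open>k\<close> of the Fibonacci matrix, then the
  power \<open>8 - k\<close> moves it to the first basis vector.
\<close>

lemma fib_mat_column:
  fixes a c :: 3
  assumes "a \<noteq> 0 \<or> c \<noteq> 0"
  shows "\<exists>n::nat. \<exists>b' d'. fib_mat [^]\<^bsub>GL\<^esub> n ** mat2 a b c d = mat2 1 b' 0 d'"
proof -
  consider "a = 1" "c = 0" | "a = 0" "c = 1" | "a = 1" "c = 1" | "a = 1" "c = 2"
    | "a = 2" "c = 0" | "a = 0" "c = 2" | "a = 2" "c = 2" | "a = 2" "c = 1"
    using three_cases[of a] three_cases[of c] assms by blast
  thus ?thesis
  proof cases
    case 1 show ?thesis by (rule exI[of _ 0], unfold fib_mat_pow) (simp add: 1)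
  next
    case 2 show ?thesis by (rule exI[of _ 7], unfold fib_mat_pow) (simp add: 2)
  next
    case 3 show ?thesis by (rule exI[of _ 6], unfold fib_mat_pow) (simp add: 3)
  next
    case 4 show ?thesis by (rule exI[of _ 5], unfold fib_mat_pow) (simp add: 4)
  next
    case 5 show ?thesis by (rule exI[of _ 4], unfold fib_mat_pow) (simp add: 5)
  next
    case 6 show ?thesis by (rule exI[of _ 3], unfold fib_mat_pow) (simp add: 6)
  next
    case 7 show ?thesis by (rule exI[of _ 2], unfold fib_mat_pow) (simp add: 7)
  next
    case 8 show ?thesis by (rule exI[of _ 1], unfold fib_mat_pow) (simp add: 8)
  qed
qed

text \<open>
  Transitivity on nonzero vectors reduces an invertible matrix to one that fixes the first basis
  vector. The shear generates half of the stabilizer of that vector, and the diagonal matrix with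
  entries 1 and \<open>-1\<close> is needed for the other half.
\<close>

lemma GL_generated:
  assumes H: "subgroup H (GL :: (3 ^ 2 ^ 2) monoid)" and swap: "swap_mat \<in> H" and shear: "shear_mat \<in> H"
  shows "H = carrier GL"
proof
  show "H \<subseteq> carrier GL" by (rule subgroup.subset[OF H])
  have mult: "A ** B \<in> H" if "A \<in> H" "B \<in> H" for A B
    using subgroup.m_closed[OF H that] by simp
  have fib: "fib_mat \<in> H" using mult[OF swap shear] by simp
  have one: "mat2 1 0 0 1 \<in> H" using subgroup.one_closed[OF H] by (simp add: mat_1_mat2)
  have shear2: "mat2 1 2 0 1 \<in> H" using mult[OF shear shear] by simp
  \<comment> \<open>The product \<open>y x y\<^sup>-\<^sup>1 x y\<close> is a quarter turn of the plane; one more swap makes it diagonal.\<close>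
  have "mat2 1 0 0 2 = shear_mat ** swap_mat ** (mat2 1 2 0 1 ** swap_mat) ** (shear_mat ** swap_mat)"
    by simp
  hence diag: "mat2 1 0 0 2 \<in> H"
    using mult[OF mult[OF mult[OF shear swap] mult[OF shear2 swap]] mult[OF shear swap]]
    by (simp only:)
  have tri: "mat2 1 b 0 d \<in> H" if "d \<noteq> 0" for b d :: 3
    using three_cases[of b] three_cases[of d] that one shear shear2 diag
      mult[OF diag shear] mult[OF diag shear2] by auto
  show "carrier GL \<subseteq> H"
  proof
    fix A :: "3 ^ 2 ^ 2" assume A: "A \<in> carrier GL"
    obtain a b c d where abcd: "A = mat2 a b c d" by (rule mat2_cases)
    from A obtain B where "B ** A = mat 1" unfolding GL_def invertible_def by auto
    hence ac: "a \<noteq> 0 \<or> c \<noteq> 0"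
      by (cases B rule: mat2_cases) (auto simp: abcd mat_1_mat2)
    obtain n :: nat and b' d' where n: "fib_mat [^]\<^bsub>GL\<^esub> n ** A = mat2 1 b' 0 d'"
      using fib_mat_column[OF ac] unfolding abcd by blast
    let ?P = "fib_mat [^]\<^bsub>GL\<^esub> n"
    have P: "?P \<in> carrier GL" "?P \<in> H"
      by (simp, induction n) (use subgroup.one_closed[OF H] mult[OF _ fib] in auto)
    have M: "?P \<otimes>\<^bsub>GL\<^esub> A \<in> carrier GL" by (rule GL.m_closed[OF P(1) A])
    then obtain B where "(?P ** A) ** B = mat 1" unfolding GL_def invertible_def by auto
    hence "d' \<noteq> 0"
      by (cases B rule: mat2_cases) (auto simp: n mat_1_mat2)
    hence "?P \<otimes>\<^bsub>GL\<^esub> A \<in> H" using tri n by simp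
    hence "inv\<^bsub>GL\<^esub> ?P \<otimes>\<^bsub>GL\<^esub> (?P \<otimes>\<^bsub>GL\<^esub> A) \<in> H"
      by (rule subgroup.m_closed[OF H subgroup.m_inv_closed[OF H P(2)]])
    also have "inv\<^bsub>GL\<^esub> ?P \<otimes>\<^bsub>GL\<^esub> (?P \<otimes>\<^bsub>GL\<^esub> A) = A"
      using P A by (simp only: GL.m_assoc[symmetric] GL.inv_closed GL.l_inv GL.l_one)
    finally show "A \<in> H" .
  qed
qed

section \<open>The homomorphism to matrices and its kernel\<close>

abbreviation Bolza_relator :: "tri_gen free_elem set" where
  "Bolza_relator \<equiv> (g\<alpha> \<otimes>\<^bsub>Delta334\<^esub> g\<beta>) [^]\<^bsub>Delta334\<^esub> (2::nat) \<otimes>\<^bsub>Delta334\<^esub>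
     (g\<alpha> [^]\<^bsub>Delta334\<^esub> (2::nat) \<otimes>\<^bsub>Delta334\<^esub> g\<beta> [^]\<^bsub>Delta334\<^esub> (2::nat)) [^]\<^bsub>Delta334\<^esub> (2::nat)"

text \<open>
  Squares of \<open>\<alpha>\<close> and \<open>\<beta>\<close> are inverses, so the second factor of the relator becomes the inverse of
  \<open>(xyxy)\<^sup>2\<close>.
\<close>

lemma Delta_embedding_Bolza_relator:
  "Delta_embedding Bolza_relator = (gy \<otimes>\<^bsub>Delta238\<^esub> gx) [^]\<^bsub>Delta238\<^esub> (4::nat) \<otimes>\<^bsub>Delta238\<^esub>
     inv\<^bsub>Delta238\<^esub> ((gx \<otimes>\<^bsub>Delta238\<^esub> gy) [^]\<^bsub>Delta238\<^esub> (4::nat))"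
proof -
  interpret e: group_hom Delta334 Delta238 Delta_embedding
    using Delta_embedding_hom
    by (simp add: group_hom_def group_hom_axioms_def group_Delta334 group_Delta238)
  let ?b = "gx \<otimes>\<^bsub>Delta238\<^esub> gy \<otimes>\<^bsub>Delta238\<^esub> gx" and ?i = "inv\<^bsub>Delta238\<^esub> gy"
  let ?q = "gy \<otimes>\<^bsub>Delta238\<^esub> gx" and ?p = "gx \<otimes>\<^bsub>Delta238\<^esub> gy"
  have y2: "gy [^]\<^bsub>Delta238\<^esub> (2::nat) = ?i"
    using Delta238_relations(2)
    by (intro D.inv_equality[symmetric]) (simp_all add: numeral_3_eq_3 numeral_2_eq_2)
  have b2: "?b [^]\<^bsub>Delta238\<^esub> (2::nat) = gx \<otimes>\<^bsub>Delta238\<^esub> ?i \<otimes>\<^bsub>Delta238\<^esub> gx"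
    using D.conj_pow[of gx gy 2] by (simp add: inv_gx y2)
  have "gy \<otimes>\<^bsub>Delta238\<^esub> ?b = ?q [^]\<^bsub>Delta238\<^esub> (2::nat)"
    by (simp add: numeral_2_eq_2 D.m_assoc)
  hence 1: "(gy \<otimes>\<^bsub>Delta238\<^esub> ?b) [^]\<^bsub>Delta238\<^esub> (2::nat) = ?q [^]\<^bsub>Delta238\<^esub> (4::nat)"
    by (simp add: D.nat_pow_pow)
  have "?i \<otimes>\<^bsub>Delta238\<^esub> (gx \<otimes>\<^bsub>Delta238\<^esub> ?i \<otimes>\<^bsub>Delta238\<^esub> gx) = inv\<^bsub>Delta238\<^esub> (?p [^]\<^bsub>Delta238\<^esub> (2::nat))"
    by (simp add: numeral_2_eq_2 D.m_assoc D.inv_mult_group inv_gx)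
  hence 2: "(?i \<otimes>\<^bsub>Delta238\<^esub> (gx \<otimes>\<^bsub>Delta238\<^esub> ?i \<otimes>\<^bsub>Delta238\<^esub> gx)) [^]\<^bsub>Delta238\<^esub> (2::nat)
      = inv\<^bsub>Delta238\<^esub> (?p [^]\<^bsub>Delta238\<^esub> (4::nat))"
    by (simp add: D.nat_pow_inv D.nat_pow_pow)
  show ?thesis
    by (simp add: e.hom_nat_pow Delta_embedding_alpha Delta_embedding_beta y2 b2 1 2)
qed

lemma Delta238_generated:
  assumes "subgroup H Delta238" "gx \<in> H" "gy \<in> H"
  shows "H = carrier Delta238"
proof -
  have "presented_gen (triangle_relators 2 3 8) t \<in> H" for t
    using assms(2,3) by (cases t) (simp_all only: gx_def gy_def)
  thus ?thesis
    using assms(1) unfolding Delta238_def triangle_group_def by (intro presented_group_generated)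
qed

definition to_GL :: "tri_gen free_elem set \<Rightarrow> 3 ^ 2 ^ 2" where
  "to_GL = presented_lift GL (case_tri_gen swap_mat shear_mat)"

lemma to_GL:
  shows to_GL_hom: "to_GL \<in> hom Delta238 GL"
    and to_GL_gx: "to_GL gx = swap_mat"
    and to_GL_gy: "to_GL gy = shear_mat"
proof -
  have 1: "swap_mat [^]\<^bsub>GL\<^esub> (2::nat) = \<one>\<^bsub>GL\<^esub>" "shear_mat [^]\<^bsub>GL\<^esub> (3::nat) = \<one>\<^bsub>GL\<^esub>"
    by (simp_all add: numeral_eq_Suc mat_1_mat2)
  have 2: "(swap_mat \<otimes>\<^bsub>GL\<^esub> shear_mat) [^]\<^bsub>GL\<^esub> (8::nat) = \<one>\<^bsub>GL\<^esub>"
    by (simp add: fib_mat_pow mat_1_mat2)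
  note lift = triangle_lift[OF group_GL gens_in_GL(1,2) 1 2]
  show "to_GL \<in> hom Delta238 GL" unfolding to_GL_def Delta238_def by (rule lift)
  show "to_GL gx = swap_mat" unfolding to_GL_def gx_def by (rule lift)
  show "to_GL gy = shear_mat" unfolding to_GL_def gy_def by (rule lift)
qed

interpretation to_GL: group_hom Delta238 GL to_GL
  using to_GL_hom by (simp add: group_hom_def group_hom_axioms_def group_Delta238 group_GL)

lemma to_GL_surj: "to_GL ` carrier Delta238 = carrier GL"
proof (rule GL_generated)
  show "subgroup (to_GL ` carrier Delta238) GL" by (rule to_GL.img_is_subgroup)
  show "swap_mat \<in> to_GL ` carrier Delta238" "shear_mat \<in> to_GL ` carrier Delta238"
    by (metis to_GL_gx to_GL_gy Delta_gens_closed(1,2) imageI)+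
qed

text \<open>
  The images of \<open>xy\<close> and \<open>yx\<close> both have fourth power \<open>-1\<close>.
\<close>

lemma Bolza_group_subset_kernel: "Delta_embedding ` Bolza_group \<subseteq> kernel Delta238 GL to_GL"
proof -
  interpret f: group_hom Delta334 GL "to_GL \<circ> Delta_embedding"
    using hom_compose[OF Delta_embedding_hom to_GL_hom]
    by (simp add: group_hom_def group_hom_axioms_def group_Delta334 group_GL)
  have "(mat2 1 1 0 1 ** mat2 0 1 1 0) [^]\<^bsub>GL\<^esub> (4::nat) = fib_mat [^]\<^bsub>GL\<^esub> (4::nat)"
    by (simp add: numeral_eq_Suc mat_1_mat2)
  hence "to_GL (Delta_embedding Bolza_relator) = \<one>\<^bsub>GL\<^esub>"
    unfolding Delta_embedding_Bolza_relator
    using GL.r_inv[OF GL.nat_pow_closed[OF gens_in_GL(3), of 4]]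
    by (simp add: to_GL.hom_nat_pow to_GL_gx to_GL_gy)
  hence "Bolza_group \<subseteq> kernel Delta334 GL (to_GL \<circ> Delta_embedding)"
    unfolding Bolza_group_def
    by (intro normal_closure_least[OF f.normal_kernel]) (simp add: kernel_def)
  thus ?thesis
    using hom_in_carrier[OF Delta_embedding_hom] by (auto simp: kernel_def)
qed

text \<open>
  The six-coset decomposition holds in the quotient by the Bolza group. Lifted back, it writes an
  element \<open>g\<close> of the kernel as \<open>n t c\<^sup>j\<close> with \<open>n\<close> in the Bolza group, and matrices can only see
  \<open>t c\<^sup>j\<close>.
\<close>

lemma kernel_subset_Bolza_group: "kernel Delta238 GL to_GL \<subseteq> Delta_embedding ` Bolza_group"
proof
  let ?N = "Delta_embedding ` Bolza_group"
  let ?Q = "Delta238 Mod ?N"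
  let ?\<pi> = "\<lambda>g. ?N #>\<^bsub>Delta238\<^esub> g"
  interpret N: normal ?N Delta238 by (rule Bolza_group_normal_Delta238)
  interpret p: group_hom Delta238 ?Q ?\<pi>
    using N.r_coset_hom_Mod N.factorgroup_is_group
    by (simp add: group_hom_def group_hom_axioms_def group_Delta238)
  let ?c = "gx \<otimes>\<^bsub>Delta238\<^esub> gy" and ?q = "gy \<otimes>\<^bsub>Delta238\<^esub> gx"
  have in_N: "?\<pi> g = \<one>\<^bsub>?Q\<^esub> \<longleftrightarrow> g \<in> ?N" if "g \<in> carrier Delta238" for g
    using D.coset_join1[OF _ that N.is_subgroup] D.coset_join2[OF that N.is_subgroup]
    by (auto simp: FactGroup_def)
  have gy_eq: "gx \<otimes>\<^bsub>Delta238\<^esub> ?c = gy"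
    using gx_square by (simp add: D.m_assoc[symmetric])
  interpret Q: central_fourth_power ?Q "?\<pi> gx" "?\<pi> ?c"
  proof (unfold_locales)
    show "?\<pi> gx \<in> carrier ?Q" "?\<pi> ?c \<in> carrier ?Q" by (rule p.hom_closed; simp)+
    show "?\<pi> gx \<otimes>\<^bsub>?Q\<^esub> ?\<pi> gx = \<one>\<^bsub>?Q\<^esub>"
      by (simp only: p.hom_mult[symmetric] Delta_gens_closed gx_square p.hom_one)
    show "(?\<pi> gx \<otimes>\<^bsub>?Q\<^esub> ?\<pi> ?c) [^]\<^bsub>?Q\<^esub> (3::nat) = \<one>\<^bsub>?Q\<^esub>"
      by (simp only: p.hom_mult[symmetric] p.hom_nat_pow[symmetric] Delta_gens_closed
          D.m_closed gy_eq Delta238_relations p.hom_one)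
    show "?\<pi> ?c [^]\<^bsub>?Q\<^esub> (8::nat) = \<one>\<^bsub>?Q\<^esub>"
      by (simp only: p.hom_nat_pow[symmetric] Delta_gens_closed
          D.m_closed Delta238_relations p.hom_one)
    have "Bolza_relator \<in> Bolza_group"
      using subset_normal_closure[of "{Bolza_relator}" Delta334] by (simp add: Bolza_group_def)
    hence "Delta_embedding Bolza_relator \<in> ?N" by (rule imageI)
    hence "?\<pi> (?q [^]\<^bsub>Delta238\<^esub> (4::nat) \<otimes>\<^bsub>Delta238\<^esub> inv\<^bsub>Delta238\<^esub> (?c [^]\<^bsub>Delta238\<^esub> (4::nat))) = \<one>\<^bsub>?Q\<^esub>"
      unfolding Delta_embedding_Bolza_relator by (subst in_N) simp_all
    hence "?\<pi> (?q [^]\<^bsub>Delta238\<^esub> (4::nat)) \<otimes>\<^bsub>?Q\<^esub> inv\<^bsub>?Q\<^esub> ?\<pi> (?c [^]\<^bsub>Delta238\<^esub> (4::nat)) = \<one>\<^bsub>?Q\<^esub>"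
      by (simp only: p.hom_mult p.hom_inv D.nat_pow_closed D.m_closed D.inv_closed
          Delta_gens_closed)
    hence "?\<pi> (?q [^]\<^bsub>Delta238\<^esub> (4::nat)) = \<one>\<^bsub>?Q\<^esub> \<otimes>\<^bsub>?Q\<^esub> ?\<pi> (?c [^]\<^bsub>Delta238\<^esub> (4::nat))"
      by (rule p.H.inv_solve_right'[THEN iffD1, rotated 3])
        (simp_all only: p.H.one_closed p.hom_closed D.nat_pow_closed D.m_closed Delta_gens_closed)
    hence eq: "?\<pi> (?q [^]\<^bsub>Delta238\<^esub> (4::nat)) = ?\<pi> (?c [^]\<^bsub>Delta238\<^esub> (4::nat))"
      by (simp only: p.H.l_one p.hom_closed D.nat_pow_closed D.m_closed Delta_gens_closed)
    have c4: "?\<pi> ?c [^]\<^bsub>?Q\<^esub> (4::nat) = ?\<pi> (?c [^]\<^bsub>Delta238\<^esub> (4::nat))"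
      by (rule p.hom_nat_pow[symmetric]) simp
    have "?\<pi> (?c [^]\<^bsub>Delta238\<^esub> (4::nat) \<otimes>\<^bsub>Delta238\<^esub> gx) = ?\<pi> (gx \<otimes>\<^bsub>Delta238\<^esub> ?q [^]\<^bsub>Delta238\<^esub> (4::nat))"
      by (simp only: D.mult_pow_swap Delta_gens_closed)
    thus "?\<pi> ?c [^]\<^bsub>?Q\<^esub> (4::nat) \<otimes>\<^bsub>?Q\<^esub> ?\<pi> gx = ?\<pi> gx \<otimes>\<^bsub>?Q\<^esub> ?\<pi> ?c [^]\<^bsub>?Q\<^esub> (4::nat)"
      unfolding c4 using eq
      by (simp only: p.hom_mult D.nat_pow_closed D.m_closed Delta_gens_closed)
  qed
  have gen: "H = carrier ?Q" if H: "subgroup H ?Q" "?\<pi> gx \<in> H" "?\<pi> ?c \<in> H" for H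
  proof -
    let ?P = "{g \<in> carrier Delta238. ?\<pi> g \<in> H}"
    interpret H: subgroup H ?Q by (rule H(1))
    have "subgroup ?P Delta238"
    proof (rule D.subgroupI)
      show "?P \<noteq> {}" using H(2) Delta_gens_closed by blast
      fix a b assume "a \<in> ?P" "b \<in> ?P"
      thus "a \<otimes>\<^bsub>Delta238\<^esub> b \<in> ?P"
        using H.m_closed[of "?\<pi> a" "?\<pi> b"]
        by (simp only: mem_Collect_eq p.hom_mult D.m_closed)
    qed auto
    moreover have "?\<pi> (gx \<otimes>\<^bsub>Delta238\<^esub> ?c) \<in> H"
      using H.m_closed[OF H(2,3)] by (subst p.hom_mult) simp_all
    ultimately have "?P = carrier Delta238"
      using H(2) by (intro Delta238_generated) (auto simp: gy_eq)
    hence "?\<pi> ` carrier Delta238 \<subseteq> H" by auto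
    hence "carrier ?Q \<subseteq> H" by (auto simp: FactGroup_def RCOSETS_def)
    thus ?thesis using H.subset by auto
  qed
  fix g assume "g \<in> kernel Delta238 GL to_GL"
  hence g: "g \<in> carrier Delta238" and g1: "to_GL g = mat 1" by (simp_all add: kernel_def)
  let ?T = "{\<one>\<^bsub>Delta238\<^esub>, gx, ?c \<otimes>\<^bsub>Delta238\<^esub> gx, ?c [^]\<^bsub>Delta238\<^esub> (2::nat) \<otimes>\<^bsub>Delta238\<^esub> gx,
    ?c [^]\<^bsub>Delta238\<^esub> (3::nat) \<otimes>\<^bsub>Delta238\<^esub> gx, gx \<otimes>\<^bsub>Delta238\<^esub> ?c [^]\<^bsub>Delta238\<^esub> (2::nat) \<otimes>\<^bsub>Delta238\<^esub> gx}"
  have T: "Q.reps = ?\<pi> ` ?T"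
    unfolding Q.reps_def
    by (simp only: image_insert image_empty p.hom_mult p.hom_nat_pow p.hom_one D.nat_pow_closed
        D.m_closed Delta_gens_closed)
  have "?\<pi> g \<in> carrier ?Q" using g by (rule p.hom_closed)
  then obtain s j where "s \<in> Q.reps" "?\<pi> g = s \<otimes>\<^bsub>?Q\<^esub> ?\<pi> ?c [^]\<^bsub>?Q\<^esub> (j::nat)"
    using Q.six_cosets[OF gen] by blast
  then obtain t where t: "t \<in> ?T" "?\<pi> g = ?\<pi> t \<otimes>\<^bsub>?Q\<^esub> ?\<pi> ?c [^]\<^bsub>?Q\<^esub> j"
    unfolding T by blast
  have tc: "t \<in> carrier Delta238" using t(1) by auto
  have "?\<pi> g = ?\<pi> (t \<otimes>\<^bsub>Delta238\<^esub> ?c [^]\<^bsub>Delta238\<^esub> j)"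
    unfolding t(2) using tc by (simp only: p.hom_mult p.hom_nat_pow D.nat_pow_closed D.m_closed
        Delta_gens_closed)
  moreover have "g \<in> ?\<pi> g" using g by (rule D.rcos_self[OF _ N.is_subgroup])
  ultimately obtain n where n: "n \<in> ?N" "g = n \<otimes>\<^bsub>Delta238\<^esub> (t \<otimes>\<^bsub>Delta238\<^esub> ?c [^]\<^bsub>Delta238\<^esub> j)"
    by (auto simp: r_coset_def)
  have n1: "n \<in> carrier Delta238" "to_GL n = mat 1"
    using n(1) Bolza_group_subset_kernel by (auto simp: kernel_def)
  have tj: "to_GL t \<otimes>\<^bsub>GL\<^esub> fib_mat [^]\<^bsub>GL\<^esub> j = \<one>\<^bsub>GL\<^esub>"
    using g1 n1 tc unfolding n(2)
    by (simp add: to_GL.hom_nat_pow to_GL_gx to_GL_gy)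
  \<comment> \<open>Of the six matrices that \<open>t\<close> may be mapped to, only the identity commutes with the Fibonacci
    matrix.\<close>
  have "to_GL t \<otimes>\<^bsub>GL\<^esub> fib_mat = fib_mat \<otimes>\<^bsub>GL\<^esub> to_GL t"
    using tj tc by (intro GL.commute_if_mult_pow_eq_one[of _ _ j]) simp_all
  hence t1: "t = \<one>\<^bsub>Delta238\<^esub>"
    using t(1) by (auto simp: to_GL.hom_nat_pow to_GL_gx to_GL_gy fib_mat_pow)
  hence "fib_mat [^]\<^bsub>GL\<^esub> j = mat 1" using tj by simp
  then obtain m where "j = 8 * m" using fib_mat_pow_eq_1 by blast
  hence "?c [^]\<^bsub>Delta238\<^esub> j = \<one>\<^bsub>Delta238\<^esub>"
    by (simp add: D.nat_pow_pow[symmetric] Delta238_relations)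
  thus "g \<in> ?N" using n(1) n1 by (simp add: n(2) t1)
qed

theorem corollary13p4:
  shows "Delta238 Mod (Delta_embedding ` Bolza_group) \<cong> (GL :: (3 ^ 2 ^ 2) monoid)"
proof -
  have "kernel Delta238 GL to_GL = Delta_embedding ` Bolza_group"
    using Bolza_group_subset_kernel kernel_subset_Bolza_group by blast
  thus ?thesis using to_GL.FactGroup_iso[OF to_GL_surj] by simp
qed

end
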